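(* Let $S=S_1\cdots S_n$ be a one-dimensional chain of $n\ge2$ qubits, $\rho$ a state of $S$, and $U$ a unitary acting nontrivially only on two neighboring qubits. Let $\nu=\sin(\min\{e(U),\pi/2\})$. Then $$|E(U\rho U^\dagger)-E(\rho)|\le\frac1{n-1}\min\Big\{8\log2,\ 8\nu\log2+3(1+\nu)\,h\Big(\frac{\nu}{1+\nu}\Big)\Big\}.$$
   Context: Natural logarithms. $h(x)=-x\log x-(1-x)\log(1-x)$ is the binary entropy. $e(U)=\min\{\|H\|_\infty: H=H^\dagger,\ \exists\chi\in\mathbb R,\ e^{-iH}=e^{-i\chi}U\}$. For a state $\sigma_{AB}$, $I(A:B)_\sigma=H(A)_\sigma+H(B)_\sigma-H(AB)_\sigma$ with $H$ the von Neumann entropy. $E(\rho)=\frac1{n-1}\sum_{j=1}^{n-1}I(S_1\cdots S_j:S_{j+1}\cdots S_n)_\rho$. *)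

theory Defs
  imports Complex_Main "Jordan_Normal_Form.Matrix" "Jordan_Normal_Form.Char_Poly"
begin

(* Operators on C^d are complex d x d matrices (JNF type complex mat).
   An n-qubit chain S_1...S_n lives on C^(2^n); basis index i < 2^n is
   the binary string of qubit values, with S_1 the most significant bit. *)

definition adj :: "complex mat \<Rightarrow> complex mat" where
  "adj A = mat (dim_col A) (dim_row A) (\<lambda>(i,j). cnj (A $$ (j,i)))"

definition tr :: "complex mat \<Rightarrow> complex" where
  "tr A = (\<Sum>i<dim_row A. A $$ (i,i))"

definition hermitian :: "nat \<Rightarrow> complex mat \<Rightarrow> bool" where
  "hermitian d A \<longleftrightarrow> A \<in> carrier_mat d d \<and> adj A = A"

definition cinner :: "complex vec \<Rightarrow> complex vec \<Rightarrow> complex" where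
  "cinner v w = (\<Sum>i<dim_vec v. cnj (v $ i) * w $ i)"

definition psd :: "nat \<Rightarrow> complex mat \<Rightarrow> bool" where
  "psd d A \<longleftrightarrow> hermitian d A \<and> (\<forall>v\<in>carrier_vec d. 0 \<le> Re (cinner v (A *\<^sub>v v)))"

definition density :: "nat \<Rightarrow> complex mat \<Rightarrow> bool" where
  "density d \<rho> \<longleftrightarrow> psd d \<rho> \<and> tr \<rho> = 1"

definition unitary :: "nat \<Rightarrow> complex mat \<Rightarrow> bool" where
  "unitary d U \<longleftrightarrow> U \<in> carrier_mat d d \<and> adj U * U = 1\<^sub>m d \<and> U * adj U = 1\<^sub>m d"

definition mat_exp :: "complex mat \<Rightarrow> complex mat" where
  "mat_exp A = mat (dim_row A) (dim_row A)
      (\<lambda>(i,j). \<Sum>k. (A ^\<^sub>m k) $$ (i,j) / of_nat (fact k))"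

definition vnorm :: "complex vec \<Rightarrow> real" where
  "vnorm v = sqrt (\<Sum>i<dim_vec v. (cmod (v $ i))\<^sup>2)"

definition opnorm :: "complex mat \<Rightarrow> real" where
  "opnorm A = Sup {vnorm (A *\<^sub>v v) | v. v \<in> carrier_vec (dim_col A) \<and> vnorm v = 1}"

definition gate_cost :: "complex mat \<Rightarrow> real" where
  "gate_cost U = Inf {opnorm H | H. hermitian (dim_row U) H \<and>
      (\<exists>\<chi>::real. mat_exp ((- \<i>) \<cdot>\<^sub>m H) = exp (- \<i> * complex_of_real \<chi>) \<cdot>\<^sub>m U)}"

definition eigvals :: "complex mat \<Rightarrow> complex list" where
  "eigvals A = (SOME as. char_poly A = (\<Prod>a\<leftarrow>as. [:- a, 1:]) \<and> length as = dim_row A)"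

definition eta :: "real \<Rightarrow> real" where
  "eta x = (if x \<le> 0 then 0 else - x * ln x)"

definition vn_entropy :: "complex mat \<Rightarrow> real" where
  "vn_entropy \<rho> = (\<Sum>a\<leftarrow>eigvals \<rho>. eta (Re a))"

definition hbin :: "real \<Rightarrow> real" where
  "hbin x = - x * ln x - (1 - x) * ln (1 - x)"

(* reduced state on A = S_1...S_j (tracing out S_{j+1}...S_n) *)
definition red_first :: "nat \<Rightarrow> nat \<Rightarrow> complex mat \<Rightarrow> complex mat" where
  "red_first n j \<rho> = mat (2^j) (2^j)
     (\<lambda>(a,a'). \<Sum>b<2^(n-j). \<rho> $$ (a * 2^(n-j) + b, a' * 2^(n-j) + b))"

(* reduced state on B = S_{j+1}...S_n (tracing out S_1...S_j) *)
definition red_last :: "nat \<Rightarrow> nat \<Rightarrow> complex mat \<Rightarrow> complex mat" where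
  "red_last n j \<rho> = mat (2^(n-j)) (2^(n-j))
     (\<lambda>(b,b'). \<Sum>a<2^j. \<rho> $$ (a * 2^(n-j) + b, a * 2^(n-j) + b'))"

definition mutual_info :: "nat \<Rightarrow> nat \<Rightarrow> complex mat \<Rightarrow> real" where
  "mutual_info n j \<rho> = vn_entropy (red_first n j \<rho>) + vn_entropy (red_last n j \<rho>) - vn_entropy \<rho>"

definition chain_E :: "nat \<Rightarrow> complex mat \<Rightarrow> real" where
  "chain_E n \<rho> = (1 / (real n - 1)) * (\<Sum>j=1..n-1. mutual_info n j \<rho>)"

(* the operator I_{2^(k-1)} \<otimes> V \<otimes> I_{2^(n-k-1)}: V (4x4) acting on qubits S_k, S_{k+1} *)
definition embed2 :: "nat \<Rightarrow> nat \<Rightarrow> complex mat \<Rightarrow> complex mat" where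
  "embed2 n k V = mat (2^n) (2^n) (\<lambda>(i,i').
     (let hi = 2^(n-k-1) :: nat in
      if i div (4*hi) = i' div (4*hi) \<and> i mod hi = i' mod hi
      then V $$ ((i div hi) mod 4, (i' div hi) mod 4) else 0))"

end

theory Submission
  imports Defs "HOL-Real_Asymp.Real_Asymp"
begin

text \<open>Only the cut between \<open>S\<^sub>k\<close> and \<open>S\<^bsub>k+1\<^esub>\<close> sees \<open>U\<close>: at every other cut \<open>U\<close> is a local unitary.
  At that cut the global entropy is unchanged, and so are the marginals on \<open>S\<^sub>1\<dots>S\<^bsub>k-1\<^esub>\<close> and
  \<open>S\<^bsub>k+2\<^esub>\<dots>S\<^sub>n\<close>; hence each of the two local entropies is that of a fixed marginal extended by one qubit,
  and moves by at most \<open>2 log 2\<close>. If \<open>e\<^bsup>-iH\<^esup>\<close> is \<open>U\<close> up to a phase with \<open>\<parallel>H\<parallel> \<le> t < \<pi>/2\<close>, then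
  \<open>U \<rho> U\<^sup>\<dagger> + N = \<rho> + P\<close> with \<open>N, P \<ge> 0\<close> of trace at most \<open>sin t\<close>. Bounding the entropy of this common
  operator below by concavity and above by subadditivity, and comparing \<open>N\<close> with \<open>P\<close> through their
  equal marginals, gives the continuity bound; finally \<open>t\<close> decreases to \<open>e(U)\<close>.\<close>

section \<open>Adjoints, unitaries and the spectral theorem\<close>

text \<open>The entropy inequalities are stated for unnormalised positive matrices, with traces as
  weights, so \<open>N\<close> and \<open>P\<close> can be used as they are. They share the relevant
  marginals because the partial trace is linear: tracing the affected qubit out of the balance
  equation cancels the marginals that \<open>U\<close> leaves fixed. The sine is the trace distance
  of a pure state from its image under a unitary whose expectation has modulus cos t; the
  eigenvalues of H, confined to [-t, t], make the real part of the expectation at least cos t.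

  The infimum in e(U) is only approached, and the mixing weights 1/(1+v) and v/(1+v) have to be
  positive. Hence everything is proved for t > e(U) with v = sin t > 0 and passed to the limit from
  the right, including the limit 0, where \<open>ln 0 = 0\<close> gives h(0) = 0 its usual value.

  At the cut the change is at most 4 log 2, and at most 4 v log 2 + 2 (1+v) h(v/(1+v)); both lie
  below the claimed bounds. For e(U) >= pi/2 one has \<nu> = 1 and the first of them
  suffices.\<close>

lemma dim_adj[simp]: "dim_row (adj A) = dim_col A" "dim_col (adj A) = dim_row A"
  by (simp_all add: adj_def)

lemma adj_carrier[simp]: "A \<in> carrier_mat n m \<Longrightarrow> adj A \<in> carrier_mat m n"
  by (auto simp: adj_def)

lemma index_adj[simp]: "i < dim_col A \<Longrightarrow> j < dim_row A \<Longrightarrow> adj A $$ (i,j) = cnj (A $$ (j,i))"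
  by (simp add: adj_def)

lemma adj_adj[simp]: "adj (adj A) = A"
  by (rule eq_matI) auto

lemma square_mult_carrier[simp]:
  "A \<in> carrier_mat d d \<Longrightarrow> B \<in> carrier_mat d d \<Longrightarrow> A * B \<in> carrier_mat d d"
  by auto

lemma index_mult_sum:
  assumes "A \<in> carrier_mat n m" "B \<in> carrier_mat m k" "i < n" "j < k"
  shows "(A * B) $$ (i,j) = (\<Sum>l<m. A $$ (i,l) * B $$ (l,j))"
  using assms by (auto simp: scalar_prod_def atLeast0LessThan intro!: sum.cong)

lemma adj_mult:
  assumes "A \<in> carrier_mat n m" "B \<in> carrier_mat m k"
  shows "adj (A * B) = adj B * adj A"
proof (rule eq_matI)
  fix i j assume ij: "i < dim_row (adj B * adj A)" "j < dim_col (adj B * adj A)"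
  hence i: "i < k" and j: "j < n" using assms by auto
  have "adj (A * B) $$ (i,j) = cnj ((A * B) $$ (j,i))" using assms i j by auto
  also have "\<dots> = cnj (\<Sum>l<m. A $$ (j,l) * B $$ (l,i))" by (simp only: index_mult_sum[OF assms j i])
  also have "\<dots> = (\<Sum>l<m. adj B $$ (i,l) * adj A $$ (l,j))"
    using assms i j by (auto intro!: sum.cong)
  also have "\<dots> = (adj B * adj A) $$ (i,j)"
    using index_mult_sum[of "adj B" k m "adj A" n i j] assms i j by auto
  finally show "adj (A * B) $$ (i,j) = (adj B * adj A) $$ (i,j)" .
qed (use assms in auto)

lemma adj_one[simp]: "adj (1\<^sub>m n) = 1\<^sub>m n"
  by (rule eq_matI) auto

lemma adj_add:
  assumes "A \<in> carrier_mat n m" "B \<in> carrier_mat n m"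
  shows "adj (A + B) = adj A + adj B"
  using assms by (intro eq_matI) auto

lemma adj_smult: "adj (c \<cdot>\<^sub>m A) = cnj c \<cdot>\<^sub>m adj A"
  by (intro eq_matI) auto

lemma unitary_carrier: "unitary d Q \<Longrightarrow> Q \<in> carrier_mat d d"
  by (simp add: unitary_def)

lemma unitaryI:
  assumes "Q \<in> carrier_mat d d" "adj Q * Q = 1\<^sub>m d"
  shows "unitary d Q"
  using assms mat_mult_left_right_inverse[of "adj Q" d Q] by (auto simp: unitary_def)

lemma unitary_adj: "unitary d Q \<Longrightarrow> unitary d (adj Q)"
  by (simp add: unitary_def)

lemma unitary_mult:
  assumes "unitary d P" "unitary d Q"
  shows "unitary d (P * Q)"
proof (rule unitaryI)
  have P: "P \<in> carrier_mat d d" "adj P * P = 1\<^sub>m d" and Q: "Q \<in> carrier_mat d d" "adj Q * Q = 1\<^sub>m d"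
    using assms by (auto simp: unitary_def)
  show "P * Q \<in> carrier_mat d d" using P Q by auto
  have "adj (P * Q) * (P * Q) = adj Q * (adj P * P) * Q"
    using P(1) Q(1) by (simp add: adj_mult[of _ d d _ d] assoc_mult_mat[of _ d d _ d _ d])
  also have "\<dots> = 1\<^sub>m d" using P Q by simp
  finally show "adj (P * Q) * (P * Q) = 1\<^sub>m d" .
qed

section \<open>Unitary diagonalisation of normal matrices by deflation\<close>

definition diagm :: "nat \<Rightarrow> (nat \<Rightarrow> complex) \<Rightarrow> complex mat" where
  "diagm d f = mat d d (\<lambda>(i,j). if i = j then f i else 0)"

lemma diagm_carrier[simp]: "diagm d f \<in> carrier_mat d d"
  by (simp add: diagm_def)

lemma dim_diagm[simp]: "dim_row (diagm d f) = d" "dim_col (diagm d f) = d"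
  by (simp_all add: diagm_def)

lemma index_diagm[simp]: "i < d \<Longrightarrow> j < d \<Longrightarrow> diagm d f $$ (i,j) = (if i = j then f i else 0)"
  by (simp add: diagm_def)

lemma adj_diagm: "adj (diagm d f) = diagm d (\<lambda>i. cnj (f i))"
  by (rule eq_matI) auto

lemma diagm_mult: "diagm d f * diagm d g = diagm d (\<lambda>i. f i * g i)"
proof (rule eq_matI)
  fix i j assume "i < dim_row (diagm d (\<lambda>i. f i * g i))" "j < dim_col (diagm d (\<lambda>i. f i * g i))"
  hence ij: "i < d" "j < d" by auto
  have "(diagm d f * diagm d g) $$ (i,j) = (\<Sum>l<d. (if l = i then f i * (if i = j then g i else 0) else 0))"
    unfolding index_mult_sum[OF diagm_carrier diagm_carrier ij]
    using ij by (intro sum.cong) auto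
  also have "\<dots> = diagm d (\<lambda>i. f i * g i) $$ (i,j)" using ij by simp
  finally show "(diagm d f * diagm d g) $$ (i,j) = diagm d (\<lambda>i. f i * g i) $$ (i,j)" .
qed auto

lemma index_conj_diag:
  assumes W: "W \<in> carrier_mat n m" and ij: "i < n" "j < n"
  shows "(W * diagm m f * adj W) $$ (i,j) = (\<Sum>k<m. W $$ (i,k) * f k * cnj (W $$ (j,k)))"
proof -
  have 1: "(W * diagm m f) $$ (i,k) = W $$ (i,k) * f k" if k: "k < m" for k
  proof -
    have "(W * diagm m f) $$ (i,k) = (\<Sum>l<m. if l = k then W $$ (i,k) * f k else 0)"
      unfolding index_mult_sum[OF W diagm_carrier ij(1) k] using k by (intro sum.cong) auto
    thus ?thesis using k by simp
  qed
  show ?thesis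
    using W ij by (subst index_mult_sum[of _ n m _ n]) (auto intro!: sum.cong simp: 1 simp del: index_mult_mat(1))
qed

lemma unitary_cols:
  assumes "unitary d Q" "i < d" "j < d"
  shows "(\<Sum>k<d. cnj (Q $$ (k,i)) * Q $$ (k,j)) = (if i = j then 1 else 0)"
proof -
  have Q: "Q \<in> carrier_mat d d" "adj Q * Q = 1\<^sub>m d" using assms by (auto simp: unitary_def)
  have "(adj Q * Q) $$ (i,j) = (\<Sum>k<d. cnj (Q $$ (k,i)) * Q $$ (k,j))"
    using Q(1) assms by (subst index_mult_sum[of _ d d _ d]) (auto intro!: sum.cong)
  thus ?thesis using Q assms by simp
qed

lemma unitary_col_norm:
  assumes "unitary d Q" "j < d"
  shows "(\<Sum>k<d. (cmod (Q $$ (k,j)))\<^sup>2) = 1"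
proof -
  have "complex_of_real (\<Sum>k<d. (cmod (Q $$ (k,j)))\<^sup>2) = (\<Sum>k<d. cnj (Q $$ (k,j)) * Q $$ (k,j))"
    by (simp add: complex_norm_square mult.commute del: of_real_power)
  also have "\<dots> = 1" using unitary_cols[OF assms(1,2,2)] by simp
  finally show ?thesis by (simp only: of_real_eq_1_iff)
qed

lemma unitary_row_norm:
  assumes "unitary d Q" "j < d"
  shows "(\<Sum>k<d. (cmod (Q $$ (j,k)))\<^sup>2) = 1"
  using unitary_col_norm[OF unitary_adj[OF assms(1)] assms(2)] unitary_carrier[OF assms(1)] assms(2)
  by auto

text \<open>The reflection along \<open>w = u - e_0\<close> exchanges \<open>e_0\<close> and the
  unit vector \<open>u\<close> as soon as their inner product is real, hence the condition on
  \<open>u $ 0\<close>. Here |w|^2 = 2 - 2 r, so \<open>c\<close> is 2 / |w|^2, and r \<le> 0 keeps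
  the denominator away from 0.\<close>

lemma householder:
  fixes u :: "complex vec"
  assumes n: "0 < n" and u: "(\<Sum>i<n. (cmod (u $ i))\<^sup>2) = 1" and u0: "u $ 0 = complex_of_real r" "r \<le> 0"
  shows "\<exists>W. unitary n W \<and> (\<forall>i<n. W $$ (i,0) = u $ i)"
proof -
  define w where "w i = u $ i - (if i = 0 then 1 else 0)" for i
  define c where "c = complex_of_real (1 / (1 - r))"
  define W where "W = mat n n (\<lambda>(i,j). (if i = j then 1 else 0) - c * w i * cnj (w j))"
  have r: "1 - complex_of_real r \<noteq> 0" using u0(2)
    by (auto simp: complex_eq_iff)
  have "(\<Sum>i<n. cmod (w i)^2) = (\<Sum>i<n. (cmod (u $ i))\<^sup>2 + (if i = 0 then 1 - 2 * r else 0))"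
  proof (rule sum.cong)
    fix i show "cmod (w i)^2 = (cmod (u $ i))\<^sup>2 + (if i = 0 then 1 - 2 * r else 0)"
    proof (cases "i = 0")
      case True
      have "w 0 = complex_of_real (r - 1)" by (simp add: w_def u0)
      hence "cmod (w 0)^2 = (r - 1)^2" by (simp only: norm_of_real power2_abs)
      thus ?thesis using True u0 by (simp add: power2_eq_square algebra_simps)
    qed (simp add: w_def)
  qed simp
  also have "\<dots> = 2 - 2 * r" using n by (simp add: sum.distrib u)
  finally have "complex_of_real (\<Sum>i<n. cmod (w i)^2) = complex_of_real (2 - 2 * r)" by simp
  hence ww: "(\<Sum>k<n. cnj (w k) * w k) = 2 - 2 * complex_of_real r"
    by (simp add: complex_norm_square mult.commute del: of_real_power)
  have W: "W \<in> carrier_mat n n" by (simp add: W_def)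
  have "adj W * W = 1\<^sub>m n"
  proof (rule eq_matI)
    fix i j assume "i < dim_row (1\<^sub>m n :: complex mat)" "j < dim_col (1\<^sub>m n :: complex mat)"
    hence ij: "i < n" "j < n" by auto
    have "(adj W * W) $$ (i,j) = (\<Sum>k<n. cnj (W $$ (k,i)) * W $$ (k,j))"
      using W ij by (subst index_mult_sum[of _ n n _ n]) (auto intro!: sum.cong)
    also have "\<dots> = (\<Sum>k<n. (if k = i then (if i = j then 1 else 0) - c * w i * cnj (w j) else 0)
         - (if k = j then c * w i * cnj (w j) else 0) + c * c * w i * cnj (w j) * (cnj (w k) * w k))"
      using ij by (intro sum.cong) (auto simp: W_def c_def algebra_simps)
    also have "\<dots> = (if i = j then 1 else 0) - 2 * c * w i * cnj (w j) + c * c * w i * cnj (w j) * (2 - 2 * complex_of_real r)"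
      using ij by (simp add: sum.distrib sum_subtractf ww flip: sum_distrib_left)
    also have "\<dots> = (if i = j then 1 else 0) + 2 * c * w i * cnj (w j) * (c * (1 - complex_of_real r) - 1)"
      by (simp add: algebra_simps)
    also have "c * (1 - complex_of_real r) = 1" using r by (simp add: c_def)
    finally show "(adj W * W) $$ (i,j) = 1\<^sub>m n $$ (i,j)" using ij by simp
  qed (use W in auto)
  hence "unitary n W" using W by (rule unitaryI[rotated])
  moreover have "W $$ (i,0) = u $ i" if i: "i < n" for i
  proof -
    have "c * cnj (w 0) = -1" using r by (simp add: c_def w_def u0 field_simps)
    hence "c * w i * cnj (w 0) = - w i" by (metis mult.assoc mult.commute mult_minus1)
    thus ?thesis using i n by (simp add: W_def w_def)
  qed
  ultimately show ?thesis by blast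
qed

lemma unit_eigenvector:
  fixes A :: "complex mat"
  assumes A: "A \<in> carrier_mat (Suc n) (Suc n)"
  shows "\<exists>u e r. u \<in> carrier_vec (Suc n) \<and> A *\<^sub>v u = e \<cdot>\<^sub>v u \<and> (\<Sum>i<Suc n. (cmod (u $ i))\<^sup>2) = 1
     \<and> u $ 0 = complex_of_real r \<and> r \<le> 0"
proof -
  obtain as where as: "char_poly A = (\<Prod>a\<leftarrow>as. [:- a, 1:])" "length as = Suc n"
    using char_poly_factorized[OF A] by blast
  then obtain e bs where "as = e # bs" by (cases as) auto
  hence "poly (char_poly A) e = 0" by (simp add: as)
  hence "eigenvalue A e" using eigenvalue_root_char_poly[OF A] by simp
  then obtain v where v: "v \<in> carrier_vec (Suc n)" "v \<noteq> 0\<^sub>v (Suc n)" "A *\<^sub>v v = e \<cdot>\<^sub>v v"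
    using A unfolding eigenvalue_def eigenvector_def by auto
  define N where "N = sqrt (\<Sum>i<Suc n. (cmod (v $ i))\<^sup>2)"
  obtain k where k: "k < Suc n" "v $ k \<noteq> 0"
    using v(1,2) by (metis carrier_vecD eq_vecI index_zero_vec)
  have "0 < (cmod (v $ k))\<^sup>2" using k by simp
  also have "\<dots> \<le> (\<Sum>i<Suc n. (cmod (v $ i))\<^sup>2)" using k by (intro member_le_sum) auto
  finally have N: "N > 0" "N^2 = (\<Sum>i<Suc n. (cmod (v $ i))\<^sup>2)" by (auto simp: N_def)
  \<comment> \<open>The phase that turns \<open>v $ 0\<close> into minus its modulus, as
    \<open>householder\<close> requires.\<close>
  define p where "p = (if v $ 0 = 0 then 1 else - cnj (v $ 0) / cmod (v $ 0))"
  have p: "cmod p = 1" by (simp add: p_def norm_divide)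
  have p0: "p * v $ 0 = - complex_of_real (cmod (v $ 0))"
    by (simp add: p_def mult.commute[of "cnj _"] complex_norm_square[symmetric] power2_eq_square)
  define u where "u = (p / N) \<cdot>\<^sub>v v"
  have "A *\<^sub>v u = (p / N) \<cdot>\<^sub>v (A *\<^sub>v v)"
    unfolding u_def by (rule mult_mat_vec[OF A v(1)])
  also have "\<dots> = e \<cdot>\<^sub>v u" unfolding v(3) u_def by (simp add: smult_smult_assoc mult.commute)
  finally have Au: "A *\<^sub>v u = e \<cdot>\<^sub>v u" .
  have ui: "u $ i = p / N * v $ i" if "i < Suc n" for i using v(1) that by (simp add: u_def)
  have "(\<Sum>i<Suc n. (cmod (u $ i))\<^sup>2) = (\<Sum>i<Suc n. (cmod (v $ i))\<^sup>2 / N^2)"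
    using N p by (intro sum.cong) (simp_all add: ui norm_mult norm_divide power_divide)
  also have "\<dots> = (\<Sum>i<Suc n. (cmod (v $ i))\<^sup>2) / N^2" by (rule sum_divide_distrib[symmetric])
  also have "\<dots> = 1" using N(1) by (simp flip: N(2) del: sum.lessThan_Suc)
  finally have 1: "(\<Sum>i<Suc n. (cmod (u $ i))\<^sup>2) = 1" .
  have "u $ 0 = complex_of_real (- cmod (v $ 0) / N)" using p0 by (simp add: ui)
  moreover have "- cmod (v $ 0) / N \<le> 0" using N by simp
  moreover have "u \<in> carrier_vec (Suc n)" using v by (simp add: u_def)
  ultimately show ?thesis using Au 1 by blast
qed

text \<open>A Householder unitary moves a unit eigenvector to the first coordinate; normality then
  clears the first row as well as the first column, and the remaining block is again normal. Stating
  this for normal matrices covers Hamiltonians and gates at once.\<close>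

lemma normal_spectral:
  assumes "A \<in> carrier_mat n n" "A * adj A = adj A * A"
  shows "\<exists>Q f. unitary n Q \<and> A = Q * diagm n f * adj Q"
  using assms
proof (induction n arbitrary: A)
  case 0
  have "unitary 0 (1\<^sub>m 0)" by (auto simp: unitary_def)
  moreover have "A = 1\<^sub>m 0 * diagm 0 (\<lambda>_. 0) * adj (1\<^sub>m 0)" using 0 by (intro eq_matI) auto
  ultimately show ?case by blast
next
  case (Suc n)
  let ?n = "Suc n"
  note A = Suc.prems
  obtain u e r where u: "u \<in> carrier_vec ?n" "A *\<^sub>v u = e \<cdot>\<^sub>v u" "(\<Sum>i<?n. (cmod (u $ i))\<^sup>2) = 1"
     "u $ 0 = complex_of_real r" "r \<le> 0"
    using unit_eigenvector[OF A(1)] by blast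
  obtain W where W: "unitary ?n W" "\<And>i. i < ?n \<Longrightarrow> W $$ (i,0) = u $ i"
    using householder[OF _ u(3-5)] by auto
  have Wc: "W \<in> carrier_mat ?n ?n" and WW: "adj W * W = 1\<^sub>m ?n" "W * adj W = 1\<^sub>m ?n"
    using W by (auto simp: unitary_def)
  note as = assoc_mult_mat[of _ ?n ?n _ ?n _ ?n]
  define B where "B = adj W * A * W"
  have B: "B \<in> carrier_mat ?n ?n" using A Wc by (simp add: B_def)
  have adjB: "adj B = adj W * adj A * W"
    using A Wc by (simp add: B_def adj_mult[of _ ?n ?n _ ?n] as)
  have cancel: "W * (adj W * X) = X" if "X \<in> carrier_mat ?n ?n" for X
    using that Wc WW by (simp flip: as)
  have nB: "B * adj B = adj B * B"
  proof -
    have "B * adj B = adj W * (A * adj A) * W" 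
      using A(1) Wc unfolding adjB unfolding B_def by (simp add: as cancel)
    also have "\<dots> = adj W * (adj A * A) * W" using A(2) by simp
    also have "\<dots> = adj B * B"
      using A(1) Wc unfolding adjB unfolding B_def by (simp add: as cancel)
    finally show ?thesis .
  qed
  have AW: "(A * W) $$ (l,0) = e * W $$ (l,0)" if l: "l < ?n" for l
  proof -
    have "col W 0 = u" using W(2) Wc u(1) by (intro eq_vecI) auto
    hence "(A * W) $$ (l,0) = (A *\<^sub>v u) $ l" using l A Wc by simp
    thus ?thesis using l u W by simp
  qed
  have B0: "B $$ (i,0) = (if i = 0 then e else 0)" if i: "i < ?n" for i
  proof -
    have "B $$ (i,0) = (\<Sum>l<?n. adj W $$ (i,l) * (A * W) $$ (l,0))"
      unfolding B_def using A Wc i by (simp only: as adj_carrier) (subst index_mult_sum[of _ ?n ?n _ ?n], auto)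
    also have "\<dots> = e * (\<Sum>l<?n. cnj (W $$ (l,i)) * W $$ (l,0))"
      unfolding sum_distrib_left using AW Wc i by (intro sum.cong) auto
    also have "\<dots> = (if i = 0 then e else 0)" using unitary_cols[OF W(1) i, of 0] by simp
    finally show ?thesis .
  qed
  have BBij: "(\<Sum>l<?n. B $$ (i,l) * cnj (B $$ (j,l))) = (\<Sum>l<?n. cnj (B $$ (l,i)) * B $$ (l,j))"
    if ij: "i < ?n" "j < ?n" for i j
  proof -
    have "(B * adj B) $$ (i,j) = (\<Sum>l<?n. B $$ (i,l) * cnj (B $$ (j,l)))"
      using B ij by (subst index_mult_sum[of _ ?n ?n _ ?n]) (auto intro!: sum.cong)
    moreover have "(adj B * B) $$ (i,j) = (\<Sum>l<?n. cnj (B $$ (l,i)) * B $$ (l,j))"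
      using B ij by (subst index_mult_sum[of _ ?n ?n _ ?n]) (auto intro!: sum.cong)
    ultimately show ?thesis using nB by simp
  qed
  \<comment> \<open>The (0,0) entries of \<open>B * adj B\<close> and \<open>adj B * B\<close> are
    the squared norms of row 0 and of column 0. Both contain |e|^2, and the column contains nothing
    else.\<close>
  have 0: "B $$ (0, Suc l) = 0" if l: "l < n" for l
  proof -
    have "(\<Sum>l<n. B $$ (0, Suc l) * cnj (B $$ (0, Suc l))) = 0"
      using BBij[of 0 0] by (simp add: sum.lessThan_Suc_shift B0 mult.commute del: sum.lessThan_Suc)
    hence "complex_of_real (\<Sum>l<n. (cmod (B $$ (0, Suc l)))\<^sup>2) = 0"
      by (simp add: complex_norm_square del: of_real_power)
    hence "(\<Sum>l<n. (cmod (B $$ (0, Suc l)))\<^sup>2) = 0" by (simp only: of_real_eq_0_iff)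
    thus ?thesis using l by (subst (asm) sum_nonneg_eq_0_iff) auto
  qed
  define B' where "B' = mat n n (\<lambda>(i,j). B $$ (Suc i, Suc j))"
  have B': "B' \<in> carrier_mat n n" by (simp add: B'_def)
  have "B' * adj B' = adj B' * B'"
  proof (rule eq_matI)
    fix i j assume "i < dim_row (adj B' * B')" "j < dim_col (adj B' * B')"
    hence ij: "i < n" "j < n" using B' by auto
    have "(B' * adj B') $$ (i,j) = (\<Sum>l<n. B $$ (Suc i,Suc l) * cnj (B $$ (Suc j,Suc l)))"
      using B' ij by (subst index_mult_sum[of _ n n _ n]) (auto intro!: sum.cong simp: B'_def)
    also have "\<dots> = (\<Sum>l<n. cnj (B $$ (Suc l,Suc i)) * B $$ (Suc l,Suc j))"
      using BBij[of "Suc i" "Suc j"] ij by (simp add: sum.lessThan_Suc_shift B0 0 del: sum.lessThan_Suc)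
    also have "\<dots> = (adj B' * B') $$ (i,j)"
      using B' ij by (subst index_mult_sum[of _ n n _ n]) (auto intro!: sum.cong simp: B'_def)
    finally show "(B' * adj B') $$ (i,j) = (adj B' * B') $$ (i,j)" .
  qed (use B' in auto)
  then obtain Q f where Q: "unitary n Q" "B' = Q * diagm n f * adj Q" using Suc.IH[OF B'] by blast
  have Qc: "Q \<in> carrier_mat n n" using Q by (simp add: unitary_def)
  define R where "R = mat ?n ?n (\<lambda>(i,j). if i = 0 \<and> j = 0 then 1 else if i = 0 \<or> j = 0 then 0 else Q $$ (i-1,j-1))"
  have R: "R \<in> carrier_mat ?n ?n" by (simp add: R_def)
  have Rij: "R $$ (0,0) = 1" "\<And>i. i < n \<Longrightarrow> R $$ (Suc i,0) = 0" "\<And>i. i < n \<Longrightarrow> R $$ (0,Suc i) = 0"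
     "\<And>i j. i < n \<Longrightarrow> j < n \<Longrightarrow> R $$ (Suc i,Suc j) = Q $$ (i,j)"
    by (auto simp: R_def)
  have uR: "unitary ?n R"
  proof (rule unitaryI[OF R], rule eq_matI)
    fix i j assume "i < dim_row (1\<^sub>m ?n :: complex mat)" "j < dim_col (1\<^sub>m ?n :: complex mat)"
    hence ij: "i < ?n" "j < ?n" by auto
    have "(adj R * R) $$ (i,j) = (\<Sum>l<?n. cnj (R $$ (l,i)) * R $$ (l,j))"
      using R ij by (subst index_mult_sum[of _ ?n ?n _ ?n]) (auto intro!: sum.cong)
    also have "\<dots> = 1\<^sub>m ?n $$ (i,j)" using ij
      by (cases i; cases j) (auto simp: sum.lessThan_Suc_shift Rij unitary_cols[OF Q(1)] simp del: sum.lessThan_Suc)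
    finally show "(adj R * R) $$ (i,j) = 1\<^sub>m ?n $$ (i,j)" .
  qed (use R in auto)
  define g where "g = case_nat e f"
  have BR: "B = R * diagm ?n g * adj R"
  proof (rule eq_matI)
    fix i j assume "i < dim_row (R * diagm ?n g * adj R)" "j < dim_col (R * diagm ?n g * adj R)"
    hence ij: "i < ?n" "j < ?n" using R by auto
    have "B $$ (i,j) = (\<Sum>k<?n. R $$ (i,k) * g k * cnj (R $$ (j,k)))"
    proof (cases i; cases j)
      fix a b assume ab: "i = Suc a" "j = Suc b"
      hence "B $$ (i,j) = B' $$ (a,b)" using ij by (simp add: B'_def)
      also have "\<dots> = (\<Sum>k<n. Q $$ (a,k) * f k * cnj (Q $$ (b,k)))"
        unfolding Q(2) using ab ij by (intro index_conj_diag[OF Qc]) auto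
      finally show ?thesis using ab ij by (simp add: sum.lessThan_Suc_shift Rij g_def del: sum.lessThan_Suc)
    qed (use ij in \<open>auto simp: B0 0 sum.lessThan_Suc_shift Rij g_def simp del: sum.lessThan_Suc\<close>)
    thus "B $$ (i,j) = (R * diagm ?n g * adj R) $$ (i,j)" by (simp only: index_conj_diag[OF R ij])
  qed (use B R in auto)
  have "A = W * B * adj W"
    using A(1) Wc WW unfolding B_def by (simp add: as cancel)
  also have "\<dots> = (W * R) * diagm ?n g * adj (W * R)"
    unfolding BR using Wc R by (simp add: as adj_mult[of _ ?n ?n _ ?n])
  finally show ?case using unitary_mult[OF W(1) uR] by blast
qed

section \<open>Entropy of positive semidefinite matrices\<close>

lemma index_conj:
  assumes W: "W \<in> carrier_mat n m" and X: "X \<in> carrier_mat m m" and ij: "i < n" "j < n"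
  shows "(W * X * adj W) $$ (i,j) = (\<Sum>k<m. \<Sum>l<m. W $$ (i,k) * X $$ (k,l) * cnj (W $$ (j,l)))"
proof -
  have "(W * X * adj W) $$ (i,j) = (\<Sum>l<m. (\<Sum>k<m. W $$ (i,k) * X $$ (k,l)) * cnj (W $$ (j,l)))"
    using W X ij by (subst index_mult_sum[of _ n m _ n])
      (auto intro!: sum.cong simp: index_mult_sum[OF W X] simp del: index_mult_mat(1))
  also have "\<dots> = (\<Sum>k<m. \<Sum>l<m. W $$ (i,k) * X $$ (k,l) * cnj (W $$ (j,l)))"
    unfolding sum_distrib_right by (rule sum.swap)
  finally show ?thesis .
qed

lemma tr_mult_commute:
  assumes "A \<in> carrier_mat n m" "B \<in> carrier_mat m n"
  shows "tr (A * B) = tr (B * A)"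
proof -
  have "tr (A * B) = (\<Sum>i<n. \<Sum>l<m. A $$ (i,l) * B $$ (l,i))"
    using assms by (auto simp: tr_def index_mult_sum[OF assms] simp del: index_mult_mat(1) intro!: sum.cong)
  also have "\<dots> = (\<Sum>l<m. \<Sum>i<n. A $$ (i,l) * B $$ (l,i))" by (rule sum.swap)
  also have "\<dots> = tr (B * A)"
    using assms by (auto simp: tr_def index_mult_sum[OF assms(2,1)] mult.commute simp del: index_mult_mat(1) intro!: sum.cong)
  finally show ?thesis .
qed

lemma tr_add:
  assumes "A \<in> carrier_mat n n" "B \<in> carrier_mat n n"
  shows "tr (A + B) = tr A + tr B"
  using assms by (auto simp: tr_def sum.distrib)

lemma tr_smult: "A \<in> carrier_mat n n \<Longrightarrow> tr (c \<cdot>\<^sub>m A) = c * tr A"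
  by (auto simp: tr_def sum_distrib_left)

lemma tr_unitary_conj:
  assumes Q: "unitary d Q" and X: "X \<in> carrier_mat d d"
  shows "tr (Q * X * adj Q) = tr X"
proof -
  have Qc: "Q \<in> carrier_mat d d" using Q by (simp add: unitary_def)
  have "tr (Q * X * adj Q) = tr (adj Q * (Q * X))"
    using Qc X by (intro tr_mult_commute[of _ d d]) auto
  also have "adj Q * (Q * X) = adj Q * Q * X" using Qc X by (simp add: assoc_mult_mat[of _ d d _ d _ d])
  finally show ?thesis using Q X by (simp add: unitary_def)
qed

lemma cinner_mult_mat_vec:
  assumes "A \<in> carrier_mat d d"
  shows "cinner (vec d f) (A *\<^sub>v vec d f) = (\<Sum>i<d. \<Sum>j<d. cnj (f i) * A $$ (i,j) * f j)"
proof -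
  have "(A *\<^sub>v vec d f) $ i = (\<Sum>j<d. A $$ (i,j) * f j)" if "i < d" for i
    using assms that by (auto simp: scalar_prod_def atLeast0LessThan intro!: sum.cong)
  hence "cinner (vec d f) (A *\<^sub>v vec d f) = (\<Sum>i<d. cnj (f i) * (\<Sum>j<d. A $$ (i,j) * f j))"
    unfolding cinner_def by (intro sum.cong) auto
  thus ?thesis by (simp only: sum_distrib_left mult.assoc)
qed

lemma psdD:
  assumes "psd d A"
  shows "0 \<le> Re (\<Sum>i<d. \<Sum>j<d. cnj (f i) * A $$ (i,j) * f j)"
proof -
  have "A \<in> carrier_mat d d" "0 \<le> Re (cinner (vec d f) (A *\<^sub>v vec d f))"
    using assms by (auto simp: psd_def hermitian_def)
  thus ?thesis by (simp only: cinner_mult_mat_vec)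
qed

lemma psdI:
  assumes "hermitian d A" "\<And>f. 0 \<le> Re (\<Sum>i<d. \<Sum>j<d. cnj (f i) * A $$ (i,j) * f j)"
  shows "psd d A"
  unfolding psd_def
proof (intro conjI ballI)
  fix v :: "complex vec" assume "v \<in> carrier_vec d"
  hence v: "v = vec d (\<lambda>i. v $ i)" by auto
  have "A \<in> carrier_mat d d" using assms(1) by (simp add: hermitian_def)
  thus "0 \<le> Re (cinner v (A *\<^sub>v v))"
    using assms(2) by (subst (1 2) v) (simp only: cinner_mult_mat_vec)
qed (fact assms)

lemma psd_carrier: "psd d A \<Longrightarrow> A \<in> carrier_mat d d"
  by (simp add: psd_def hermitian_def)

lemma psd_adj: "psd d A \<Longrightarrow> adj A = A"
  by (simp add: psd_def hermitian_def)

lemma hermitian_entry: "hermitian d A \<Longrightarrow> i < d \<Longrightarrow> j < d \<Longrightarrow> cnj (A $$ (i,j)) = A $$ (j,i)"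
  by (metis hermitian_def carrier_matD index_adj)

lemma hermitianI:
  assumes "A \<in> carrier_mat d d" "\<And>i j. i < d \<Longrightarrow> j < d \<Longrightarrow> cnj (A $$ (i,j)) = A $$ (j,i)"
  shows "hermitian d A"
  unfolding hermitian_def using assms by (auto intro!: eq_matI)

lemma psd_diag:
  assumes "psd d A" "i < d"
  shows "0 \<le> Re (A $$ (i,i))"
proof -
  have "(\<Sum>k<d. \<Sum>l<d. cnj (if k = i then 1 else 0) * A $$ (k,l) * (if l = i then 1 else 0))
      = (\<Sum>k<d. \<Sum>l<d. if l = i then if k = i then A $$ (i,i) else 0 else 0)"
    by (intro sum.cong) auto
  also have "\<dots> = A $$ (i,i)" using assms(2) by simp
  finally show ?thesis using psdD[OF assms(1), of "\<lambda>k. if k = i then 1 else 0"] by simp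
qed

lemma psd_add:
  assumes "psd d A" "psd d B"
  shows "psd d (A + B)"
proof (rule psdI)
  have c: "A \<in> carrier_mat d d" "B \<in> carrier_mat d d" using assms by (auto dest: psd_carrier)
  show "hermitian d (A + B)" using assms c by (simp add: hermitian_def adj_add[of _ d d] psd_adj)
  fix f
  have "(\<Sum>i<d. \<Sum>j<d. cnj (f i) * (A + B) $$ (i,j) * f j)
     = (\<Sum>i<d. \<Sum>j<d. cnj (f i) * A $$ (i,j) * f j) + (\<Sum>i<d. \<Sum>j<d. cnj (f i) * B $$ (i,j) * f j)"
    unfolding sum.distrib[symmetric] using c by (intro sum.cong) (auto simp: algebra_simps)
  thus "0 \<le> Re (\<Sum>i<d. \<Sum>j<d. cnj (f i) * (A + B) $$ (i,j) * f j)"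
    using psdD[OF assms(1), of f] psdD[OF assms(2), of f] by simp
qed

text \<open>The form of \<open>M * A * adj M\<close> at \<open>f\<close> is the form of
  \<open>A\<close> at \<open>adj M\<close> applied to \<open>f\<close>. \<open>M\<close> may be
  rectangular.\<close>

lemma psd_conj:
  assumes A: "psd n A" and M: "M \<in> carrier_mat m n"
  shows "psd m (M * A * adj M)"
proof (rule psdI)
  have c: "A \<in> carrier_mat n n" using A by (rule psd_carrier)
  have MA: "M * A \<in> carrier_mat m n" using M c by (rule mult_carrier_mat)
  have "adj (M * A * adj M) = M * (A * adj M)"
    using adj_mult[OF MA adj_carrier[OF M]] adj_mult[OF M c] psd_adj[OF A] by simp
  also have "\<dots> = M * A * adj M" by (rule assoc_mult_mat[OF M c adj_carrier[OF M], symmetric])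
  finally show "hermitian m (M * A * adj M)" unfolding hermitian_def
    using mult_carrier_mat[OF MA adj_carrier[OF M]] by simp
  fix f
  define g where "g k = (\<Sum>i<m. cnj (M $$ (i,k)) * f i)" for k
  have "(\<Sum>i<m. \<Sum>j<m. cnj (f i) * (M * A * adj M) $$ (i,j) * f j)
      = (\<Sum>i<m. \<Sum>j<m. \<Sum>k<n. \<Sum>l<n. cnj (f i) * M $$ (i,k) * A $$ (k,l) * (cnj (M $$ (j,l)) * f j))"
    by (intro sum.cong) (auto simp: index_conj[OF M c] sum_distrib_left sum_distrib_right mult.assoc simp del: index_mult_mat(1))
  also have "\<dots> = (\<Sum>i<m. \<Sum>k<n. \<Sum>j<m. \<Sum>l<n. cnj (f i) * M $$ (i,k) * A $$ (k,l) * (cnj (M $$ (j,l)) * f j))"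
    by (intro sum.cong refl sum.swap)
  also have "\<dots> = (\<Sum>k<n. \<Sum>i<m. \<Sum>j<m. \<Sum>l<n. cnj (f i) * M $$ (i,k) * A $$ (k,l) * (cnj (M $$ (j,l)) * f j))"
    by (rule sum.swap)
  also have "\<dots> = (\<Sum>k<n. \<Sum>i<m. \<Sum>l<n. \<Sum>j<m. cnj (f i) * M $$ (i,k) * A $$ (k,l) * (cnj (M $$ (j,l)) * f j))"
    by (intro sum.cong refl sum.swap)
  also have "\<dots> = (\<Sum>k<n. \<Sum>l<n. \<Sum>i<m. \<Sum>j<m. cnj (f i) * M $$ (i,k) * A $$ (k,l) * (cnj (M $$ (j,l)) * f j))"
    by (intro sum.cong refl sum.swap)
  also have "\<dots> = (\<Sum>k<n. \<Sum>l<n. cnj (g k) * A $$ (k,l) * g l)"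
    by (simp add: g_def sum_distrib_left sum_distrib_right mult.assoc mult.commute mult.left_commute)
  finally show "0 \<le> Re (\<Sum>i<m. \<Sum>j<m. cnj (f i) * (M * A * adj M) $$ (i,j) * f j)"
    using psdD[OF A, of g] by simp
qed

lemma unitary_conj_cancel:
  assumes Q: "unitary d Q" and D: "D \<in> carrier_mat d d"
  shows "adj Q * (Q * D * adj Q) * Q = D" "Q * (adj Q * D * Q) * adj Q = D"
proof -
  have c: "Q \<in> carrier_mat d d" "adj Q * Q = 1\<^sub>m d" "Q * adj Q = 1\<^sub>m d" using Q by (auto simp: unitary_def)
  note as = assoc_mult_mat[of _ d d _ d _ d]
  have 1: "adj Q * (Q * X) = X" "Q * (adj Q * X) = X" if "X \<in> carrier_mat d d" for X
    using that c by (simp_all flip: as)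
  show "adj Q * (Q * D * adj Q) * Q = D" "Q * (adj Q * D * Q) * adj Q = D"
    using c D by (simp_all add: as 1)
qed

section \<open>Entropy read off from a diagonalisation\<close>

lemma hermitian_spectral:
  assumes X: "hermitian d X"
  shows "\<exists>Q l. unitary d Q \<and> X = Q * diagm d (\<lambda>i. complex_of_real (l i)) * adj Q"
proof -
  have c: "X \<in> carrier_mat d d" "adj X = X" using X by (auto simp: hermitian_def)
  obtain Q f where Q: "unitary d Q" "X = Q * diagm d f * adj Q"
    using normal_spectral[of X d] c by auto
  have Qc: "Q \<in> carrier_mat d d" using Q by (simp add: unitary_def)
  have D: "diagm d f = adj Q * X * Q" using unitary_conj_cancel(1)[OF Q(1) diagm_carrier] Q(2) by simp
  have "adj (diagm d f) = diagm d f"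
    unfolding D using Qc c by (simp add: adj_mult[of _ d d _ d] assoc_mult_mat[of _ d d _ d _ d])
  hence "cnj (f i) = f i" if "i < d" for i using that index_adj[of i "diagm d f" i] by simp
  hence "diagm d (\<lambda>i. complex_of_real (Re (f i))) = diagm d f"
    by (intro eq_matI) (auto simp: complex_eq_iff)
  thus ?thesis using Q by metis
qed

lemma psd_spectral:
  assumes X: "psd d X"
  shows "\<exists>Q l. unitary d Q \<and> (\<forall>i<d. 0 \<le> l i) \<and> X = Q * diagm d (\<lambda>i. complex_of_real (l i)) * adj Q"
proof -
  obtain Q l where Q: "unitary d Q" "X = Q * diagm d (\<lambda>i. complex_of_real (l i)) * adj Q"
    using hermitian_spectral X unfolding psd_def by blast
  have Qc: "Q \<in> carrier_mat d d" using Q by (simp add: unitary_def)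
  have "psd d (adj Q * X * adj (adj Q))" using X Qc by (intro psd_conj) auto
  hence "psd d (diagm d (\<lambda>i. complex_of_real (l i)))"
    using unitary_conj_cancel(1)[OF Q(1) diagm_carrier] Q(2) by simp
  hence "\<forall>i<d. 0 \<le> l i" using psd_diag by fastforce
  thus ?thesis using Q by blast
qed

text \<open>\<open>eigvals\<close> is a choice of roots in an unspecified order, so only its
  multiset is determined; unique factorisation of the characteristic polynomial, through
  \<open>proots\<close>, identifies it. This is enough for the entropy, which is a symmetric
  sum.\<close>

lemma eigvals_spectral:
  assumes Q: "unitary d Q" and X: "X = Q * diagm d f * adj Q"
  shows "mset (eigvals X) = mset (map f [0..<d])"
proof -
  have Qc: "Q \<in> carrier_mat d d" using Q by (simp add: unitary_def)
  have Xc: "X \<in> carrier_mat d d" using X Qc by simp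
  have "similar_mat_wit X (diagm d f) Q (adj Q)"
    using Q X Qc Xc by (intro similar_mat_witI[of _ _ d]) (auto simp: unitary_def)
  hence "char_poly X = char_poly (diagm d f)"
    by (intro char_poly_similar) (auto simp: similar_mat_def)
  also have "\<dots> = (\<Prod>a\<leftarrow>diag_mat (diagm d f). [:- a, 1:])"
    by (rule char_poly_upper_triangular[OF diagm_carrier]) auto
  also have "diag_mat (diagm d f) = map f [0..<d]" by (auto simp: diag_mat_def)
  finally have cp: "char_poly X = (\<Prod>a\<leftarrow>map f [0..<d]. [:- a, 1:])" .
  have "\<exists>as. char_poly X = (\<Prod>a\<leftarrow>as. [:- a, 1:]) \<and> length as = dim_row X"
    using char_poly_factorized[OF Xc] Xc by auto
  hence ev: "char_poly X = (\<Prod>a\<leftarrow>eigvals X. [:- a, 1:])"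
    unfolding eigvals_def by (rule someI2_ex) auto
  have roots: "proots (\<Prod>a\<leftarrow>as. [:- a, 1:]) = mset as" for as :: "complex list"
  proof (induction as)
    case (Cons a as)
    have "(\<Prod>a\<leftarrow>as. [:- a, 1:]) \<noteq> 0" by (auto simp: prod_list_zero_iff)
    hence "proots ([:- a, 1:] * (\<Prod>a\<leftarrow>as. [:- a, 1:])) = proots [:- a, 1:] + mset as"
      using Cons by (subst proots_mult) auto
    thus ?case by simp
  qed simp
  show ?thesis using roots[of "eigvals X"] roots[of "map f [0..<d]"] cp ev by simp
qed

lemma vn_entropy_spectral:
  assumes Q: "unitary d Q" and X: "X = Q * diagm d f * adj Q"
  shows "vn_entropy X = (\<Sum>i<d. eta (Re (f i)))"
proof -
  have "vn_entropy X = sum_mset (image_mset (\<lambda>a. eta (Re a)) (mset (eigvals X)))"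
    by (simp add: vn_entropy_def flip: sum_mset_sum_list mset_map)
  also have "\<dots> = sum_mset (image_mset (\<lambda>i. eta (Re (f i))) (mset [0..<d]))"
    unfolding eigvals_spectral[OF assms] mset_map by (simp add: image_mset.compositionality o_def)
  also have "\<dots> = (\<Sum>i<d. eta (Re (f i)))"
    by (simp only: mset_upt atLeast0LessThan sum_unfold_sum_mset)
  finally show ?thesis .
qed

lemma vn_entropy_unitary_conj:
  assumes U: "unitary d U" and X: "psd d X"
  shows "vn_entropy (U * X * adj U) = vn_entropy X"
proof -
  obtain Q l where Q: "unitary d Q" "X = Q * diagm d (\<lambda>i. complex_of_real (l i)) * adj Q"
    using psd_spectral[OF X] by blast
  have c: "Q \<in> carrier_mat d d" "U \<in> carrier_mat d d" using Q U by (auto simp: unitary_def)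
  have "U * X * adj U = (U * Q) * diagm d (\<lambda>i. complex_of_real (l i)) * adj (U * Q)"
    unfolding Q(2) using c by (simp add: adj_mult[of _ d d _ d] assoc_mult_mat[of _ d d _ d _ d])
  from vn_entropy_spectral[OF unitary_mult[OF U Q(1)] this] vn_entropy_spectral[OF Q]
  show ?thesis by simp
qed

text \<open>The numbers <q_i, X q_i> for the columns q_i of \<open>Q\<close>; for a state, the
  outcome probabilities of a measurement in this basis.\<close>

definition diag_in :: "complex mat \<Rightarrow> complex mat \<Rightarrow> nat \<Rightarrow> real" where
  "diag_in Q X i = Re ((adj Q * X * Q) $$ (i,i))"

lemma diag_in_add:
  assumes "Q \<in> carrier_mat d d" "X \<in> carrier_mat d d" "Y \<in> carrier_mat d d" "i < d"
  shows "diag_in Q (X + Y) i = diag_in Q X i + diag_in Q Y i"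
proof -
  have "adj Q * (X + Y) * Q = adj Q * X * Q + adj Q * Y * Q"
    using assms by (simp add: mult_add_distrib_mat[of _ d d _ d] add_mult_distrib_mat[of _ d d _ _ d])
  moreover have "adj Q * X * Q \<in> carrier_mat d d" "adj Q * Y * Q \<in> carrier_mat d d"
    using assms by simp_all
  ultimately show ?thesis using assms(4) by (simp add: diag_in_def del: index_mult_mat)
qed

lemma diag_in_nonneg:
  assumes "Q \<in> carrier_mat d d" "psd d X" "i < d"
  shows "0 \<le> diag_in Q X i"
  using psd_diag[OF psd_conj[OF assms(2), of "adj Q" d] assms(3)] assms by (simp add: diag_in_def del: index_mult_mat)

lemma diag_in_sum:
  assumes Q: "unitary d Q" and X: "X \<in> carrier_mat d d"
  shows "(\<Sum>i<d. diag_in Q X i) = Re (tr X)"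
proof -
  have "adj Q * X * Q \<in> carrier_mat d d" using X Q by (simp add: unitary_def)
  hence "(\<Sum>i<d. diag_in Q X i) = Re (tr (adj Q * X * Q))" by (auto simp: tr_def diag_in_def simp del: index_mult_mat)
  thus ?thesis using tr_unitary_conj[OF unitary_adj[OF Q] X] by simp
qed

lemma diag_in_eigenbasis:
  assumes Q: "unitary d Q" and X: "X = Q * diagm d f * adj Q" and i: "i < d"
  shows "diag_in Q X i = Re (f i)"
  using unitary_conj_cancel(1)[OF Q diagm_carrier[of d f]] i by (simp add: diag_in_def X del: index_mult_mat)

section \<open>Entropy inequalities from comparing two orthonormal bases\<close>

lemma change_basis:
  assumes Q: "unitary d Q" and R: "unitary d R" and X: "X = R * diagm d f * adj R"
  shows "adj Q * X * Q = (adj Q * R) * diagm d f * adj (adj Q * R)"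
proof -
  have c: "Q \<in> carrier_mat d d" "R \<in> carrier_mat d d" using Q R by (auto simp: unitary_def)
  thus ?thesis unfolding X by (simp add: adj_mult[of _ d d _ d] assoc_mult_mat[of _ d d _ d _ d])
qed

text \<open>When \<open>W\<close> is the transition matrix between two orthonormal bases, its
  squared moduli are doubly stochastic, so the diagonal in the new basis averages the
  eigenvalues.\<close>

lemma diag_in_transition:
  assumes W: "W \<in> carrier_mat d d" and "adj Q * X * Q = W * diagm d (\<lambda>i. complex_of_real (l i)) * adj W"
    and i: "i < d"
  shows "diag_in Q X i = (\<Sum>k<d. (cmod (W $$ (i,k)))\<^sup>2 * l k)"
proof -
  have "(adj Q * X * Q) $$ (i,i) = (\<Sum>k<d. W $$ (i,k) * complex_of_real (l k) * cnj (W $$ (i,k)))"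
    unfolding assms(2) by (rule index_conj_diag[OF W i i])
  also have "\<dots> = complex_of_real (\<Sum>k<d. (cmod (W $$ (i,k)))\<^sup>2 * l k)"
    by (simp add: complex_norm_square mult_ac del: of_real_power)
  finally show ?thesis by (simp add: diag_in_def)
qed

text \<open>The right-hand side is the tangent of the concave function \<open>eta\<close> at
  \<open>m\<close>, rewritten.\<close>

lemma eta_tangent:
  assumes "0 \<le> x" "0 < m"
  shows "eta x \<le> - x * ln m + m - x"
proof (cases "x = 0")
  case False
  hence x: "x > 0" using assms by simp
  have "ln (m / x) \<le> m / x - 1" using x assms by (intro ln_le_minus_one) auto
  hence "x * ln (m / x) \<le> x * (m / x - 1)" using x by (intro mult_left_mono) auto
  thus ?thesis using x assms by (simp add: eta_def ln_div algebra_simps)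
qed (use assms in \<open>simp add: eta_def\<close>)

text \<open>Averaging the tangent at the mean \<open>m\<close>. At m = 0 there is no tangent, but
  then every term has weight 0 or argument 0.\<close>

lemma eta_jensen:
  fixes n :: nat
  assumes "\<And>i. i < n \<Longrightarrow> 0 \<le> p i" "(\<Sum>i<n. p i) = 1" "\<And>i. i < n \<Longrightarrow> 0 \<le> x i"
  shows "(\<Sum>i<n. p i * eta (x i)) \<le> eta (\<Sum>i<n. p i * x i)"
proof -
  define m where "m = (\<Sum>i<n. p i * x i)"
  have nn: "p i * x i \<ge> 0" if "i < n" for i using that assms by simp
  hence m0: "m \<ge> 0" unfolding m_def by (intro sum_nonneg) auto
  show ?thesis
  proof (cases "m = 0")
    case True
    hence "p i * x i = 0" if "i < n" for i
      using that nn sum_nonneg_eq_0_iff[of "{..<n}" "\<lambda>i. p i * x i"] by (auto simp: m_def)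
    hence "p i * eta (x i) = 0" if "i < n" for i using that by (fastforce simp: eta_def)
    hence "(\<Sum>i<n. p i * eta (x i)) = 0" by (intro sum.neutral) simp
    thus ?thesis using True by (simp add: m_def[symmetric] eta_def)
  next
    case False
    hence m: "m > 0" using m0 by simp
    have "(\<Sum>i<n. p i * eta (x i)) \<le> (\<Sum>i<n. p i * (- x i * ln m + m - x i))"
      using assms m by (intro sum_mono mult_left_mono eta_tangent) auto
    also have "\<dots> = (\<Sum>i<n. - ln m * (p i * x i) + m * p i - p i * x i)"
      by (intro sum.cong) (auto simp: algebra_simps)
    also have "\<dots> = - ln m * m + m * 1 - m"
      by (simp add: sum.distrib sum_subtractf m_def sum_negf flip: sum_distrib_left assms(2))
    also have "\<dots> = eta m" using m by (simp add: eta_def)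
    finally show ?thesis by (simp add: m_def)
  qed
qed

text \<open>Measuring in any basis can only raise the entropy: row sums equal to 1 allow Jensen for
  each diagonal entry, and column sums equal to 1 recover the sum over the eigenvalues.\<close>

lemma vn_entropy_le_diag_in:
  assumes Q: "unitary d Q" and X: "psd d X"
  shows "vn_entropy X \<le> (\<Sum>i<d. eta (diag_in Q X i))"
proof -
  obtain R l where R: "unitary d R" "\<forall>i<d. 0 \<le> l i" "X = R * diagm d (\<lambda>i. complex_of_real (l i)) * adj R"
    using psd_spectral[OF X] by blast
  define W where "W = adj Q * R"
  have W: "unitary d W" unfolding W_def using Q R by (intro unitary_mult unitary_adj)
  have tr: "diag_in Q X i = (\<Sum>k<d. (cmod (W $$ (i,k)))\<^sup>2 * l k)" if "i < d" for i
    by (rule diag_in_transition[OF unitary_carrier[OF W] _ that]) (unfold W_def, rule change_basis[OF Q R(1,3)])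
  have "vn_entropy X = (\<Sum>k<d. eta (l k))" using vn_entropy_spectral[OF R(1,3)] by simp
  also have "\<dots> = (\<Sum>k<d. (\<Sum>i<d. (cmod (W $$ (i,k)))\<^sup>2) * eta (l k))"
    using unitary_col_norm[OF W] by simp
  also have "\<dots> = (\<Sum>i<d. \<Sum>k<d. (cmod (W $$ (i,k)))\<^sup>2 * eta (l k))"
    unfolding sum_distrib_right by (rule sum.swap)
  also have "\<dots> \<le> (\<Sum>i<d. eta (diag_in Q X i))"
    using R(2) unitary_row_norm[OF W] by (intro sum_mono) (auto simp: tr intro!: eta_jensen)
  finally show ?thesis .
qed

text \<open>The right-hand side is \<open>- tr (X ln Z)\<close>, so this is the consequence of operator monotonicity of
  the logarithm for \<open>X \<le> Z\<close>. Junk value \<open>ln 0 = 0\<close> is harmless: \<open>diag_in Q X i = 0\<close> when \<open>z i = 0\<close>.\<close>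

lemma vn_entropy_ge_cross:
  assumes X: "psd d X" and Q: "unitary d Q" and Z: "Z = Q * diagm d (\<lambda>i. complex_of_real (z i)) * adj Q"
    and le: "psd d (Z - X)"
  shows "(\<Sum>i<d. diag_in Q X i * (- ln (z i))) \<le> vn_entropy X"
proof -
  obtain R l where R: "unitary d R" "\<forall>i<d. 0 \<le> l i" "X = R * diagm d (\<lambda>i. complex_of_real (l i)) * adj R"
    using psd_spectral[OF X] by blast
  define W where "W = adj Q * R"
  have W: "unitary d W" unfolding W_def using Q R by (intro unitary_mult unitary_adj)
  have Wc: "W \<in> carrier_mat d d" using W by (rule unitary_carrier)
  have Qc: "Q \<in> carrier_mat d d" using Q by (rule unitary_carrier)
  have Xc: "X \<in> carrier_mat d d" using X by (rule psd_carrier)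
  have Zc: "Z \<in> carrier_mat d d" using Qc Z by simp
  have XW: "adj Q * X * Q = W * diagm d (\<lambda>i. complex_of_real (l i)) * adj W"
    unfolding W_def by (rule change_basis[OF Q R(1,3)])
  have tr: "diag_in Q X i = (\<Sum>k<d. (cmod (W $$ (i,k)))\<^sup>2 * l k)" if "i < d" for i
    by (rule diag_in_transition[OF Wc XW that])
  define D where "D = adj Q * (Z - X) * adj (adj Q)"
  have psdD': "psd d D" unfolding D_def using le Qc by (intro psd_conj) auto
  have Deq: "D = diagm d (\<lambda>i. complex_of_real (z i)) - W * diagm d (\<lambda>i. complex_of_real (l i)) * adj W"
  proof -
    have "D = adj Q * Z * Q - adj Q * X * Q" unfolding D_def using Qc Xc Zc
      by (simp add: mult_minus_distrib_mat[of _ d d _ d] minus_mult_distrib_mat[of _ d d _ _ d])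
    thus ?thesis using unitary_conj_cancel(1)[OF Q diagm_carrier] XW Z by simp
  qed
  have Dij: "D $$ (i,j) = (if i = j then complex_of_real (z i) else 0)
       - (\<Sum>k<d. W $$ (i,k) * complex_of_real (l k) * cnj (W $$ (j,k)))" if "i < d" "j < d" for i j
    unfolding Deq using that Wc index_conj_diag[OF Wc that, of "\<lambda>i. complex_of_real (l i)"]
    by (simp del: index_mult_mat(1))
  \<comment> \<open>The diagonal of \<open>Z - X\<close> in the basis \<open>Q\<close> is
    nonnegative, and each summand is at most the whole nonnegative sum.\<close>
  have term_le: "(cmod (W $$ (i,k)))\<^sup>2 * l k \<le> z i" if ik: "i < d" "k < d" for i k
  proof -
    have "D $$ (i,i) = complex_of_real (z i - (\<Sum>k<d. (cmod (W $$ (i,k)))\<^sup>2 * l k))"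
      unfolding Dij[OF ik(1) ik(1)] by (simp add: complex_norm_square mult_ac del: of_real_power)
    hence "(\<Sum>k<d. (cmod (W $$ (i,k)))\<^sup>2 * l k) \<le> z i"
      using psd_diag[OF psdD' ik(1)] by simp
    moreover have "(cmod (W $$ (i,k)))\<^sup>2 * l k \<le> (\<Sum>k<d. (cmod (W $$ (i,k)))\<^sup>2 * l k)"
      using R(2) ik by (intro member_le_sum) auto
    ultimately show ?thesis by simp
  qed
  \<comment> \<open>Let r_k be column k of \<open>R\<close>. From Z \<ge> X \<ge> l_k |r_k><r_k|
    follows l_k s \<le> 1 with s = <r_k, Z^-1 r_k>. Averaging ln x \<le> x - 1 at
    \<open>x = l k / z i\<close> with the weights \<open>w i\<close> then gives the claim. Only this
    rank-one comparison is used in place of operator monotonicity.\<close>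
  have main: "(\<Sum>i<d. (cmod (W $$ (i,k)))\<^sup>2 * l k * (- ln (z i))) \<le> eta (l k)" if k: "k < d" for k
  proof (cases "l k = 0")
    case False
    hence lk: "l k > 0" using R(2) k by (simp add: order_less_le)
    define w where "w i = (cmod (W $$ (i,k)))\<^sup>2" for i
    have w0: "w i \<ge> 0" for i by (simp add: w_def)
    have zw: "z i > 0 \<or> w i = 0 \<and> z i \<ge> 0" if "i < d" for i
    proof -
      have z: "w i * l k \<le> z i" "0 \<le> w i * l k" using term_le[OF that k] w0 lk by (auto simp: w_def)
      show ?thesis
      proof (cases "w i = 0")
        case False
        hence "0 < w i * l k" using lk w0[of i] by simp
        thus ?thesis using z by linarith
      qed (use z in simp)
    qed
    have sw: "(\<Sum>i<d. w i) = 1" using unitary_col_norm[OF W k] by (simp add: w_def)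
    define s where "s = (\<Sum>i<d. w i / z i)"
    have s0: "s \<ge> 0" unfolding s_def using zw w0 by (intro sum_nonneg) (fastforce intro!: divide_nonneg_nonneg simp: order_less_le)
    \<comment> \<open>The coordinates of Z^-1 r_k in the basis \<open>Q\<close>: at this test vector
      both <f, Z f> and <r_k, f> equal \<open>s\<close>. Where \<open>z i = 0\<close> also
      \<open>W $$ (i,k) = 0\<close>, so the quotient is 0.\<close>
    define f where "f i = W $$ (i,k) / complex_of_real (z i)" for i
    have "(\<Sum>i<d. \<Sum>j<d. cnj (f i) * D $$ (i,j) * f j) = 
       (\<Sum>i<d. \<Sum>j<d. (if j = i then cnj (f i) * complex_of_real (z i) * f i else 0)
       - (\<Sum>m<d. complex_of_real (l m) * ((cnj (f i) * W $$ (i,m)) * (cnj (W $$ (j,m)) * f j))))"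
      by (intro sum.cong refl) (simp add: Dij left_diff_distrib right_diff_distrib sum_distrib_left sum_distrib_right mult_ac)
    also have "\<dots> = (\<Sum>i<d. cnj (f i) * complex_of_real (z i) * f i)
       - (\<Sum>i<d. \<Sum>j<d. \<Sum>m<d. complex_of_real (l m) * ((cnj (f i) * W $$ (i,m)) * (cnj (W $$ (j,m)) * f j)))"
      by (simp add: sum_subtractf)
    also have "(\<Sum>i<d. \<Sum>j<d. \<Sum>m<d. complex_of_real (l m) * ((cnj (f i) * W $$ (i,m)) * (cnj (W $$ (j,m)) * f j)))
      = (\<Sum>i<d. \<Sum>m<d. \<Sum>j<d. complex_of_real (l m) * ((cnj (f i) * W $$ (i,m)) * (cnj (W $$ (j,m)) * f j)))"
      by (intro sum.cong refl sum.swap)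
    also have "\<dots> = (\<Sum>m<d. \<Sum>i<d. \<Sum>j<d. complex_of_real (l m) * ((cnj (f i) * W $$ (i,m)) * (cnj (W $$ (j,m)) * f j)))"
      by (rule sum.swap)
    also have "\<dots> = (\<Sum>m<d. complex_of_real (l m) * (cnj (\<Sum>i<d. cnj (W $$ (i,m)) * f i) * (\<Sum>i<d. cnj (W $$ (i,m)) * f i)))"
      by (simp add: sum_distrib_left sum_distrib_right mult_ac)
    also have "\<dots> = complex_of_real (\<Sum>m<d. l m * (cmod (\<Sum>i<d. cnj (W $$ (i,m)) * f i))\<^sup>2)"
      by (simp add: complex_norm_square mult_ac del: of_real_power)
    also have "(\<Sum>i<d. cnj (f i) * complex_of_real (z i) * f i) = complex_of_real s"
      unfolding s_def of_real_sum
    proof (intro sum.cong refl)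
      fix i assume "i \<in> {..<d}"
      hence "z i > 0 \<or> z i = 0" using zw[of i] by auto
      thus "cnj (f i) * complex_of_real (z i) * f i = complex_of_real (w i / z i)"
        by (auto simp: f_def w_def complex_norm_square mult_ac simp del: of_real_power)
    qed
    finally have "(\<Sum>i<d. \<Sum>j<d. cnj (f i) * D $$ (i,j) * f j)
       = complex_of_real (s - (\<Sum>m<d. l m * (cmod (\<Sum>i<d. cnj (W $$ (i,m)) * f i))\<^sup>2))" 
      by (simp only: of_real_diff)
    hence "(\<Sum>m<d. l m * (cmod (\<Sum>i<d. cnj (W $$ (i,m)) * f i))\<^sup>2) \<le> s"
      using psdD[OF psdD', of f] by (simp only: Re_complex_of_real diff_ge_0_iff_ge)
    moreover have "l k * (cmod (\<Sum>i<d. cnj (W $$ (i,k)) * f i))\<^sup>2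
       \<le> (\<Sum>m<d. l m * (cmod (\<Sum>i<d. cnj (W $$ (i,m)) * f i))\<^sup>2)"
      using R(2) k by (intro member_le_sum) auto
    moreover have "(\<Sum>i<d. cnj (W $$ (i,k)) * f i) = complex_of_real s"
      unfolding s_def of_real_sum
      by (intro sum.cong refl) (simp add: f_def w_def complex_norm_square mult_ac del: of_real_power)
    ultimately have "l k * s^2 \<le> s" by simp
    hence "s * (l k * s) \<le> s * 1" by (simp add: power2_eq_square mult_ac)
    hence ls: "l k * s \<le> 1" using s0 by (cases "s = 0") (auto dest!: mult_left_le_imp_le)
    have "(\<Sum>i<d. w i * (ln (l k) - ln (z i))) \<le> (\<Sum>i<d. w i * (l k / z i - 1))"
    proof (rule sum_mono)
      fix i assume "i \<in> {..<d}"
      hence "z i > 0 \<or> w i = 0" using zw by auto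
      thus "w i * (ln (l k) - ln (z i)) \<le> w i * (l k / z i - 1)"
      proof
        assume "z i > 0"
        thus ?thesis using ln_le_minus_one[of "l k / z i"] lk w0[of i] by (intro mult_left_mono) (auto simp: ln_div)
      qed simp
    qed
    also have "\<dots> = l k * s - 1"
      by (simp add: algebra_simps sum_subtractf sw s_def sum_distrib_left)
    finally have "l k * (\<Sum>i<d. w i * (ln (l k) - ln (z i))) \<le> 0" using ls lk by (simp add: mult_le_0_iff)
    moreover have "(\<Sum>i<d. w i * (ln (l k) - ln (z i))) = ln (l k) - (\<Sum>i<d. w i * ln (z i))"
      by (simp add: right_diff_distrib sum_subtractf sw flip: sum_distrib_right)
    ultimately have "l k * ln (l k) \<le> l k * (\<Sum>i<d. w i * ln (z i))" by (simp add: right_diff_distrib)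
    moreover have "(\<Sum>i<d. w i * l k * (- ln (z i))) = - (l k * (\<Sum>i<d. w i * ln (z i)))"
      by (simp add: sum_distrib_left sum_negf mult_ac)
    ultimately show ?thesis using lk by (simp add: eta_def w_def)
  qed (simp add: eta_def)
  have "(\<Sum>i<d. diag_in Q X i * (- ln (z i))) = (\<Sum>i<d. \<Sum>k<d. (cmod (W $$ (i,k)))\<^sup>2 * l k * (- ln (z i)))"
    by (intro sum.cong refl) (simp add: tr sum_distrib_right sum_negf)
  also have "\<dots> = (\<Sum>k<d. \<Sum>i<d. (cmod (W $$ (i,k)))\<^sup>2 * l k * (- ln (z i)))" by (rule sum.swap)
  also have "\<dots> \<le> (\<Sum>k<d. eta (l k))" by (intro sum_mono) (use main in auto)
  also have "\<dots> = vn_entropy X" using vn_entropy_spectral[OF R(1,3)] by simp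
  finally show ?thesis .
qed

lemma add_minus_cancel_mat:
  assumes "A \<in> carrier_mat n m" "B \<in> carrier_mat n m"
  shows "A + B - A = (B :: complex mat)" "A + B - B = (A :: complex mat)"
  using assms by (auto intro!: eq_matI)

text \<open>With Z = X + Y the entropy of the sum is - tr (X ln Z) - tr (Y ln Z), and each part is
  bounded by \<open>vn_entropy_ge_cross\<close> since X \<le> Z and Y \<le> Z. This concerns sums of
  operators, not tensor factors.\<close>

lemma vn_entropy_subadd:
  assumes X: "psd d X" and Y: "psd d Y"
  shows "vn_entropy (X + Y) \<le> vn_entropy X + vn_entropy Y"
proof -
  have Xc: "X \<in> carrier_mat d d" and Yc: "Y \<in> carrier_mat d d" using X Y by (auto dest: psd_carrier)
  obtain Q z where Q: "unitary d Q" "\<forall>i<d. 0 \<le> z i" "X + Y = Q * diagm d (\<lambda>i. complex_of_real (z i)) * adj Q"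
    using psd_spectral[OF psd_add[OF X Y]] by blast
  have Qc: "Q \<in> carrier_mat d d" using Q by (simp add: unitary_def)
  have "vn_entropy (X + Y) = (\<Sum>i<d. eta (z i))" using vn_entropy_spectral[OF Q(1,3)] by simp
  also have "\<dots> = (\<Sum>i<d. diag_in Q (X + Y) i * (- ln (z i)))"
    using Q(2) by (intro sum.cong) (auto simp: diag_in_eigenbasis[OF Q(1,3)] eta_def)
  also have "\<dots> = (\<Sum>i<d. diag_in Q X i * (- ln (z i))) + (\<Sum>i<d. diag_in Q Y i * (- ln (z i)))"
    unfolding sum.distrib[symmetric] by (intro sum.cong) (simp_all add: diag_in_add[OF Qc Xc Yc] algebra_simps)
  also have "\<dots> \<le> vn_entropy X + vn_entropy Y"
    using add_minus_cancel_mat[OF Xc Yc] X Y by (intro add_mono vn_entropy_ge_cross[OF _ Q(1,3)]) simp_all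
  finally show ?thesis .
qed

text \<open>Tangents at \<open>p * (x + y)\<close> and \<open>q * (x + y)\<close>; their linear
  terms cancel because p + q = 1.\<close>

lemma eta_superadd:
  assumes "0 \<le> x" "0 \<le> y" "0 < p" "0 < q" "p + q = 1"
  shows "eta x + eta y + x * ln p + y * ln q \<le> eta (x + y)"
proof (cases "x + y = 0")
  case False
  hence s: "x + y > 0" using assms by simp
  have "eta x \<le> - x * ln (p * (x + y)) + p * (x + y) - x"
       "eta y \<le> - y * ln (q * (x + y)) + q * (x + y) - y"
    using s assms by (intro eta_tangent; simp)+
  moreover have "ln (p * (x + y)) = ln p + ln (x + y)" "ln (q * (x + y)) = ln q + ln (x + y)"
    using s assms by (simp_all add: ln_mult_pos)
  moreover have "p * (x + y) + q * (x + y) = x + y" using assms(5) by (simp flip: distrib_right)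
  ultimately show ?thesis using s by (simp add: eta_def algebra_simps)
qed (use assms in \<open>auto simp: eta_def add_nonneg_eq_0_iff\<close>)

text \<open>Concavity of the entropy, applied to \<open>X + Y = p (X / p) + q (Y / q)\<close>.\<close>

lemma vn_entropy_superadd:
  assumes X: "psd d X" and Y: "psd d Y" and pq: "0 < p" "0 < q" "p + q = 1"
  shows "vn_entropy X + vn_entropy Y + Re (tr X) * ln p + Re (tr Y) * ln q \<le> vn_entropy (X + Y)"
proof -
  have Xc: "X \<in> carrier_mat d d" and Yc: "Y \<in> carrier_mat d d" using X Y by (auto dest: psd_carrier)
  obtain Q z where Q: "unitary d Q" "\<forall>i<d. 0 \<le> z i" "X + Y = Q * diagm d (\<lambda>i. complex_of_real (z i)) * adj Q"
    using psd_spectral[OF psd_add[OF X Y]] by blast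
  have Qc: "Q \<in> carrier_mat d d" using Q by (simp add: unitary_def)
  \<comment> \<open>In the eigenbasis of \<open>X + Y\<close> the entropy of the sum is exact, while
    those of \<open>X\<close> and \<open>Y\<close> are at most the entropies of their diagonals. The
    operator inequality thus reduces to \<open>eta_superadd\<close>, entry by entry.\<close>
  have "vn_entropy X + vn_entropy Y + Re (tr X) * ln p + Re (tr Y) * ln q
     \<le> (\<Sum>i<d. eta (diag_in Q X i)) + (\<Sum>i<d. eta (diag_in Q Y i)) + (\<Sum>i<d. diag_in Q X i) * ln p + (\<Sum>i<d. diag_in Q Y i) * ln q"
    using vn_entropy_le_diag_in[OF Q(1) X] vn_entropy_le_diag_in[OF Q(1) Y] by (simp add: diag_in_sum[OF Q(1)] Xc Yc)
  also have "\<dots> = (\<Sum>i<d. eta (diag_in Q X i) + eta (diag_in Q Y i) + diag_in Q X i * ln p + diag_in Q Y i * ln q)"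
    by (simp add: sum.distrib sum_distrib_right)
  also have "\<dots> \<le> (\<Sum>i<d. eta (diag_in Q X i + diag_in Q Y i))"
    using pq by (intro sum_mono eta_superadd diag_in_nonneg[OF Qc]) (auto simp: X Y)
  also have "\<dots> = (\<Sum>i<d. eta (z i))"
    using diag_in_add[OF Qc Xc Yc] by (intro sum.cong) (auto simp: diag_in_eigenbasis[OF Q(1,3)] dest: sym)
  also have "\<dots> = vn_entropy (X + Y)" using vn_entropy_spectral[OF Q(1,3)] by simp
  finally show ?thesis .
qed

section \<open>Splitting off a qubit\<close>

text \<open>\<open>f s a\<close> is the basis index with value \<open>s\<close> on the distinguished
  qubit and string \<open>a\<close> on the others. Leaving its position abstract serves both sides
  of the cut: S_k is the lowest bit of the left index, S_{k+1} the highest bit of the right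
  one.\<close>

locale qubit_split =
  fixes m :: nat and f :: "bool \<Rightarrow> nat \<Rightarrow> nat" and bit :: "nat \<Rightarrow> bool" and rest :: "nat \<Rightarrow> nat"
  assumes f_less: "a < m \<Longrightarrow> f s a < 2 * m"
    and bit_f: "a < m \<Longrightarrow> bit (f s a) = s"
    and rest_f: "a < m \<Longrightarrow> rest (f s a) = a"
    and rest_less: "i < 2 * m \<Longrightarrow> rest i < m"
    and f_bit_rest: "i < 2 * m \<Longrightarrow> f (bit i) (rest i) = i"
begin

lemma sum_split:
  "(\<Sum>i<2 * m. g i) = (\<Sum>a<m. g (f False a)) + (\<Sum>a<m. g (f True a))"
proof -
  have "(\<Sum>i<2 * m. g i) = (\<Sum>(s,a)\<in>UNIV \<times> {..<m}. g (f s a))"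
    by (rule sum.reindex_bij_witness[where i = "\<lambda>(s,a). f s a" and j = "\<lambda>i. (bit i, rest i)"])
      (auto simp: f_less bit_f rest_f rest_less f_bit_rest)
  also have "\<dots> = (\<Sum>s\<in>UNIV. \<Sum>a<m. g (f s a))" by (rule sum.cartesian_product[symmetric])
  finally show ?thesis by (simp add: UNIV_bool)
qed

definition block :: "bool \<Rightarrow> complex mat \<Rightarrow> complex mat" where
  "block s X = mat m m (\<lambda>(a,b). X $$ (f s a, f s b))"

text \<open>The partial trace over the distinguished qubit.\<close>

definition marg :: "complex mat \<Rightarrow> complex mat" where
  "marg X = block False X + block True X"

definition dsum :: "(bool \<Rightarrow> complex mat) \<Rightarrow> complex mat" where
  "dsum Q = mat (2 * m) (2 * m) (\<lambda>(i,j). if bit i = bit j then Q (bit i) $$ (rest i, rest j) else 0)"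

lemma block_carrier[simp]: "block s X \<in> carrier_mat m m"
  by (simp add: block_def)

lemma index_block[simp]: "a < m \<Longrightarrow> b < m \<Longrightarrow> block s X $$ (a,b) = X $$ (f s a, f s b)"
  by (simp add: block_def)

lemma dsum_carrier[simp]: "dsum Q \<in> carrier_mat (2 * m) (2 * m)"
  by (simp add: dsum_def)

lemma index_dsum[simp]:
  "a < m \<Longrightarrow> b < m \<Longrightarrow> dsum Q $$ (f s a, f t b) = (if s = t then Q s $$ (a,b) else 0)"
  by (simp add: dsum_def f_less bit_f rest_f)

lemma tr_split:
  assumes "X \<in> carrier_mat (2 * m) (2 * m)"
  shows "tr X = tr (block False X) + tr (block True X)"
  using assms by (simp add: tr_def sum_split block_def)

lemma psd_block:
  assumes X: "psd (2 * m) X"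
  shows "psd m (block s X)"
proof (rule psdI)
  have "hermitian (2 * m) X" using X by (simp add: psd_def)
  thus "hermitian m (block s X)"
    by (intro hermitianI) (simp_all add: hermitian_entry f_less)
  fix g :: "nat \<Rightarrow> complex"
  define h where "h i = (if bit i = s then g (rest i) else 0)" for i
  have "(\<Sum>i<2 * m. \<Sum>j<2 * m. cnj (h i) * X $$ (i,j) * h j)
     = (\<Sum>i<m. \<Sum>j<m. cnj (g i) * block s X $$ (i,j) * g j)"
    by (cases s) (simp_all add: sum_split h_def bit_f rest_f)
  thus "0 \<le> Re (\<Sum>i<m. \<Sum>j<m. cnj (g i) * block s X $$ (i,j) * g j)"
    using psdD[OF X, of h] by simp
qed

lemma unitary_dsum:
  assumes Q: "\<And>s. unitary m (Q s)"
  shows "unitary (2 * m) (dsum Q)"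
proof (rule unitaryI[OF dsum_carrier], rule eq_matI)
  fix i j assume "i < dim_row (1\<^sub>m (2 * m) :: complex mat)" "j < dim_col (1\<^sub>m (2 * m) :: complex mat)"
  hence ij: "i < 2 * m" "j < 2 * m" by auto
  define s a t b where "s = bit i" and "a = rest i" and "t = bit j" and "b = rest j"
  have i: "i = f s a" "a < m" and j: "j = f t b" "b < m"
    using ij by (simp_all add: s_def a_def t_def b_def rest_less f_bit_rest)
  have eq: "f s a = f t b \<longleftrightarrow> s = t \<and> a = b" 
  proof
    assume "f s a = f t b"
    hence "bit (f s a) = bit (f t b)" "rest (f s a) = rest (f t b)" by (simp_all only:)
    thus "s = t \<and> a = b" by (simp only: bit_f[OF i(2)] bit_f[OF j(2)] rest_f[OF i(2)] rest_f[OF j(2)])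
  qed (simp only: simp_thms)
  have "(adj (dsum Q) * dsum Q) $$ (i,j) = (\<Sum>l<2 * m. cnj (dsum Q $$ (l,i)) * dsum Q $$ (l,j))"
    using ij by (subst index_mult_sum[of _ "2 * m" "2 * m" _ "2 * m"]) (auto intro!: sum.cong simp: dsum_def)
  also have "\<dots> = (if s = t then if a = b then 1 else 0 else 0)"
    using unitary_cols[OF Q i(2) j(2)]
    by (cases s; cases t) (simp_all add: sum_split i j)
  finally show "(adj (dsum Q) * dsum Q) $$ (i,j) = 1\<^sub>m (2 * m) $$ (i,j)" using ij eq i j by simp
qed (auto simp: dsum_def)

text \<open>A block-diagonal basis does not see the off-diagonal blocks of \<open>X\<close>, so
  \<open>X\<close> may be replaced by its pinching, the block-diagonal part.\<close>

lemma diag_in_dsum: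
  assumes Q: "\<And>s. Q s \<in> carrier_mat m m" and X: "X \<in> carrier_mat (2 * m) (2 * m)" and c: "c < m"
  shows "diag_in (dsum Q) X (f s c) = diag_in (Q s) (block s X) c"
proof -
  have "(adj (dsum Q) * X * adj (adj (dsum Q))) $$ (f s c, f s c)
     = (\<Sum>k<2 * m. \<Sum>l<2 * m. adj (dsum Q) $$ (f s c,k) * X $$ (k,l) * cnj (adj (dsum Q) $$ (f s c,l)))"
    by (rule index_conj[of _ "2 * m" "2 * m"]) (use X c f_less in auto)
  also have "\<dots> = (\<Sum>k<2 * m. \<Sum>l<2 * m. cnj (dsum Q $$ (k, f s c)) * X $$ (k,l) * dsum Q $$ (l,f s c))"
    using c f_less[OF c] by (intro sum.cong refl) (simp add: dsum_def)
  also have "\<dots> = (\<Sum>k<m. \<Sum>l<m. cnj (Q s $$ (k, c)) * block s X $$ (k,l) * Q s $$ (l,c))"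
    using c by (cases s) (simp_all add: sum_split)
  also have "\<dots> = (\<Sum>k<m. \<Sum>l<m. adj (Q s) $$ (c,k) * block s X $$ (k,l) * cnj (adj (Q s) $$ (c,l)))"
    using c Q[of s] by (intro sum.cong refl) simp
  also have "\<dots> = (adj (Q s) * block s X * adj (adj (Q s))) $$ (c,c)"
    by (intro index_conj[symmetric]) (use Q c in auto)
  finally show ?thesis by (simp add: diag_in_def del: index_mult_mat)
qed

text \<open>Both bounds pass through the pinching, whose entropy is the sum of the block entropies.
  Pinching raises the entropy, and merging the blocks with weights 1/2 costs at most tr X ln 2.
  Conversely X is at most twice its pinching, so the entropy of X is at least that of the pinching
  minus tr X ln 2, and subadditivity compares the blocks with their sum.\<close>

lemma vn_entropy_marg:
  assumes X: "psd (2 * m) X"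
  shows "\<bar>vn_entropy X - vn_entropy (marg X)\<bar> \<le> Re (tr X) * ln 2"
proof -
  have Xc: "X \<in> carrier_mat (2 * m) (2 * m)" using X by (rule psd_carrier)
  have "\<forall>s. \<exists>Q l. unitary m Q \<and> (\<forall>i<m. 0 \<le> l i) \<and> block s X = Q * diagm m (\<lambda>i. complex_of_real (l i)) * adj Q"
    using psd_spectral[OF psd_block[OF X]] by blast
  then obtain Q l where Q: "\<And>s. unitary m (Q s)" "\<And>s i. i < m \<Longrightarrow> 0 \<le> l s i"
      "\<And>s. block s X = Q s * diagm m (\<lambda>i. complex_of_real (l s i)) * adj (Q s)"
    by metis
  have Qc: "Q s \<in> carrier_mat m m" for s using Q(1) by (rule unitary_carrier)
  have dQ: "diag_in (dsum Q) X (f s c) = l s c" if "c < m" for s c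
    using diag_in_dsum[OF Qc Xc that] diag_in_eigenbasis[OF Q(1,3) that] by simp
  have ent: "vn_entropy (block s X) = (\<Sum>c<m. eta (l s c))" for s
    using vn_entropy_spectral[OF Q(1,3)] by simp
  have "vn_entropy X \<le> (\<Sum>i<2 * m. eta (diag_in (dsum Q) X i))"
    by (rule vn_entropy_le_diag_in[OF unitary_dsum[OF Q(1)] X])
  also have "\<dots> = vn_entropy (block False X) + vn_entropy (block True X)"
    by (simp add: sum_split dQ ent)
  also have "\<dots> \<le> vn_entropy (marg X) + Re (tr X) * ln 2"
    using vn_entropy_superadd[OF psd_block[OF X, of False] psd_block[OF X, of True], of "1/2" "1/2"]
    by (simp add: marg_def tr_split[OF Xc] ln_div algebra_simps)
  finally have up: "vn_entropy X \<le> vn_entropy (marg X) + Re (tr X) * ln 2" .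

  \<comment> \<open>The eigenvalues of twice the pinching, which \<open>Z\<close> then is.\<close>
  define z where "z i = 2 * l (bit i) (rest i)" for i
  define Z where "Z = dsum Q * diagm (2 * m) (\<lambda>i. complex_of_real (z i)) * adj (dsum Q)"
  have Zc: "Z \<in> carrier_mat (2 * m) (2 * m)" by (simp add: Z_def)
  \<comment> \<open>The diagonal of a Pauli Z, up to sign, on the distinguished qubit. Conjugating
    by it flips the off-diagonal blocks, so twice the pinching minus \<open>X\<close> is a conjugate
    of \<open>X\<close>, hence positive.\<close>
  define sg :: "nat \<Rightarrow> complex" where "sg i = (if bit i then 1 else -1)" for i
  have Zij: "Z $$ (i,j) = (if bit i = bit j then 2 * X $$ (i,j) else 0)" if "i < 2 * m" "j < 2 * m" for i j
  proof -
    define s a t b where "s = bit i" and "a = rest i" and "t = bit j" and "b = rest j"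
    have i: "i = f s a" "a < m" and j: "j = f t b" "b < m"
      using that by (simp_all add: s_def a_def t_def b_def rest_less f_bit_rest)
    have "Z $$ (i,j) = (\<Sum>k<2 * m. dsum Q $$ (i,k) * complex_of_real (z k) * cnj (dsum Q $$ (j,k)))"
      unfolding Z_def by (rule index_conj_diag[OF dsum_carrier that])
    also have "\<dots> = (if s = t then 2 * (\<Sum>k<m. Q s $$ (a,k) * complex_of_real (l s k) * cnj (Q s $$ (b,k))) else 0)"
      using i j by (cases s; cases t)
        (simp_all add: sum_split z_def bit_f rest_f sum_distrib_left mult.assoc mult.left_commute[of _ 2])
    also have "(\<Sum>k<m. Q s $$ (a,k) * complex_of_real (l s k) * cnj (Q s $$ (b,k))) = block s X $$ (a,b)"
      unfolding Q(3)[of s] by (rule index_conj_diag[OF Qc i(2) j(2), symmetric])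
    finally show ?thesis using i j by (auto simp: bit_f)
  qed
  have ZX: "(Z - X) $$ (i,j) = cnj (sg i) * X $$ (i,j) * sg j" if "i < 2 * m" "j < 2 * m" for i j
    using that Xc by (simp add: Zij sg_def)
  have "psd (2 * m) (Z - X)"
  proof (rule psdI)
    have h: "hermitian (2 * m) X" using X by (simp add: psd_def)
    show "hermitian (2 * m) (Z - X)"
    proof (rule hermitianI[OF minus_carrier_mat[OF Xc]])
      fix i j assume ij: "i < 2 * m" "j < 2 * m"
      show "cnj ((Z - X) $$ (i,j)) = (Z - X) $$ (j,i)"
        unfolding ZX[OF ij] ZX[OF ij(2,1)] by (simp add: hermitian_entry[OF h ij] sg_def)
    qed
    fix g
    have "(\<Sum>i<2 * m. \<Sum>j<2 * m. cnj (g i) * (Z - X) $$ (i,j) * g j)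
       = (\<Sum>i<2 * m. \<Sum>j<2 * m. cnj (sg i * g i) * X $$ (i,j) * (sg j * g j))"
      by (intro sum.cong refl) (simp add: ZX mult_ac del: index_minus_mat)
    thus "0 \<le> Re (\<Sum>i<2 * m. \<Sum>j<2 * m. cnj (g i) * (Z - X) $$ (i,j) * g j)"
      using psdD[OF X, of "\<lambda>i. sg i * g i"] by simp
  qed
  from vn_entropy_ge_cross[OF X unitary_dsum[OF Q(1)] Z_def this]
  have "(\<Sum>i<2 * m. diag_in (dsum Q) X i * - ln (z i)) \<le> vn_entropy X" .
  moreover have "(\<Sum>c<m. diag_in (dsum Q) X (f s c) * - ln (z (f s c))) = vn_entropy (block s X) - ln 2 * (\<Sum>c<m. l s c)" for s
    unfolding ent sum_distrib_left sum_subtractf[symmetric]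
  proof (intro sum.cong refl)
    fix c assume "c \<in> {..<m}"
    hence c: "c < m" by simp
    show "diag_in (dsum Q) X (f s c) * - ln (z (f s c)) = eta (l s c) - ln 2 * l s c"
      using Q(2)[OF c, of s] c by (auto simp: dQ z_def bit_f rest_f eta_def ln_mult algebra_simps order_less_le)
  qed
  moreover have "(\<Sum>c<m. l s c) = Re (tr (block s X))" for s
    using diag_in_sum[OF Q(1)[of s] block_carrier, of s X] by (simp add: diag_in_eigenbasis[OF Q(1,3)])
  ultimately have "vn_entropy (block False X) + vn_entropy (block True X) - ln 2 * Re (tr X) \<le> vn_entropy X"
    unfolding sum_split by (simp add: tr_split[OF Xc] distrib_left del: mult_minus_right)
  moreover have "vn_entropy (marg X) \<le> vn_entropy (block False X) + vn_entropy (block True X)"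
    unfolding marg_def by (rule vn_entropy_subadd[OF psd_block[OF X] psd_block[OF X]])
  ultimately show ?thesis using up by (simp add: abs_le_iff mult.commute)
qed

text \<open>The Alicki-Fannes-Winter argument. As \<open>N\<close> and \<open>P\<close> have the same marginal, concavity of the
  entropy alone suffices, without strong subadditivity.\<close>

lemma vn_entropy_diff_le:
  assumes X: "psd (2 * m) X" and Y: "psd (2 * m) Y" and N: "psd (2 * m) N" and P: "psd (2 * m) P"
    and eq: "X + N = Y + P" and mg: "marg N = marg P"
    and tX: "tr X = 1" and tN: "Re (tr N) \<le> v" and tP: "Re (tr P) \<le> v" and v: "0 < v"
  shows "vn_entropy X - vn_entropy Y \<le> 2 * v * ln 2 + (1 + v) * hbin (v / (1 + v))"
proof -
  \<comment> \<open>The weights of \<open>X\<close> and \<open>N\<close> in the mixture (X + N) / (1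
    + v) when \<open>N\<close> has trace \<open>v\<close>; they produce the factor (1+v)
    h(v/(1+v)).\<close>
  have 1: "1 / (1 + v) + v / (1 + v) = 1" using v by (simp add: field_simps)
  have "vn_entropy X + vn_entropy N + Re (tr X) * ln (1 / (1 + v)) + Re (tr N) * ln (v / (1 + v))
     \<le> vn_entropy (Y + P)"
    using vn_entropy_superadd[OF X N _ _ 1] v by (simp add: eq)
  also have "\<dots> \<le> vn_entropy Y + vn_entropy P" by (rule vn_entropy_subadd[OF Y P])
  finally have "vn_entropy X - vn_entropy Y
     \<le> vn_entropy P - vn_entropy N - ln (1 / (1 + v)) - Re (tr N) * ln (v / (1 + v))"
    by (simp add: tX)
  \<comment> \<open>The trace of \<open>N\<close> may be below \<open>v\<close>; as the logarithm is
    nonpositive, replacing the trace by \<open>v\<close> only weakens the bound.\<close>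
  moreover have "v * ln (v / (1 + v)) \<le> Re (tr N) * ln (v / (1 + v))"
    using tN v by (intro mult_right_mono_neg) (auto simp: ln_le_zero_iff)
  moreover have "(1 + v) * hbin (v / (1 + v)) = - v * ln (v / (1 + v)) - ln (1 / (1 + v))"
  proof -
    have "1 - v / (1 + v) = 1 / (1 + v)" using v by (simp add: field_simps)
    thus ?thesis using v by (simp add: hbin_def right_diff_distrib)
  qed
  moreover have "vn_entropy P - vn_entropy N \<le> 2 * v * ln 2"
  proof -
    have "Re (tr P) * ln 2 \<le> v * ln 2" "Re (tr N) * ln 2 \<le> v * ln 2" using tN tP by simp_all
    thus ?thesis using vn_entropy_marg[OF N] vn_entropy_marg[OF P] unfolding mg abs_le_iff by linarith
  qed
  ultimately show ?thesis by simp
qed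

lemma abs_vn_entropy_diff_le:
  assumes X: "psd (2 * m) X" and Y: "psd (2 * m) Y" and N: "psd (2 * m) N" and P: "psd (2 * m) P"
    and eq: "X + N = Y + P" and mg: "marg N = marg P"
    and tX: "tr X = 1" and tY: "tr Y = 1" and tN: "Re (tr N) \<le> v" and tP: "Re (tr P) \<le> v" and v: "0 < v"
  shows "\<bar>vn_entropy X - vn_entropy Y\<bar> \<le> 2 * v * ln 2 + (1 + v) * hbin (v / (1 + v))"
  using vn_entropy_diff_le[OF X Y N P eq mg tX tN tP v]
    vn_entropy_diff_le[OF Y X P N eq[symmetric] mg[symmetric] tY tP tN v]
  by (simp add: abs_le_iff)

lemma abs_vn_entropy_diff_le_ln2:
  assumes X: "psd (2 * m) X" and Y: "psd (2 * m) Y" and mg: "marg X = marg Y"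
    and tX: "tr X = 1" and tY: "tr Y = 1"
  shows "\<bar>vn_entropy X - vn_entropy Y\<bar> \<le> 2 * ln 2"
  using vn_entropy_marg[OF X] vn_entropy_marg[OF Y] mg tX tY by simp

end

section \<open>Partial traces and two-qubit gates\<close>

text \<open>A tensor factorisation of the index set. Since \<open>p\<close> is arbitrary, exchanging
  its arguments turns every statement about one factor into one about the other, and both reduced
  states are instances of \<open>pt\<close>. Keeping \<open>T\<close> as a parameter lets it be
  \<open>2^n\<close> literally.\<close>

locale pairing =
  fixes D E T :: nat and p :: "nat \<Rightarrow> nat \<Rightarrow> nat"
  assumes bij: "bij_betw (\<lambda>(a,b). p a b) ({..<D} \<times> {..<E}) {..<T}"
begin

lemma sum_pair: "(\<Sum>i<T. g i) = (\<Sum>a<D. \<Sum>b<E. g (p a b))"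
  using sum.reindex_bij_betw[OF bij, of g] by (simp add: sum.cartesian_product case_prod_unfold)

lemma p_less[simp]: "a < D \<Longrightarrow> b < E \<Longrightarrow> p a b < T"
  using bij_betwE[OF bij] by fastforce

lemma p_eq_iff: "a < D \<Longrightarrow> b < E \<Longrightarrow> a' < D \<Longrightarrow> b' < E \<Longrightarrow> p a b = p a' b' \<longleftrightarrow> a = a' \<and> b = b'"
  using bij_betw_imp_inj_on[OF bij] by (auto dest: inj_onD[where x = "(a,b)" and y = "(a',b')"])

lemma p_cases:
  assumes "i < T"
  obtains a b where "i = p a b" "a < D" "b < E"
proof -
  have "i \<in> (\<lambda>(a,b). p a b) ` ({..<D} \<times> {..<E})" using bij_betw_imp_surj_on[OF bij] assms by simp
  thus ?thesis using that by auto
qed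

definition pt :: "complex mat \<Rightarrow> complex mat" where
  "pt X = mat D D (\<lambda>(a,a'). \<Sum>b<E. X $$ (p a b, p a' b))"

lemma pt_carrier[simp]: "pt X \<in> carrier_mat D D"
  by (simp add: pt_def)

lemma index_pt[simp]: "a < D \<Longrightarrow> a' < D \<Longrightarrow> pt X $$ (a,a') = (\<Sum>b<E. X $$ (p a b, p a' b))"
  by (simp add: pt_def)

lemma pt_add:
  assumes "X \<in> carrier_mat T T" "Y \<in> carrier_mat T T"
  shows "pt (X + Y) = pt X + pt Y"
  using assms by (intro eq_matI) (auto simp: pt_def sum.distrib)

lemma tr_pt:
  assumes "X \<in> carrier_mat T T"
  shows "tr (pt X) = tr X"
  using assms by (simp add: tr_def sum_pair pt_def)

text \<open>The form of the partial trace at \<open>f\<close> is the sum over \<open>b\<close> of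
  the forms of \<open>X\<close> at f \<otimes> e_b. \<open>g b\<close> is this product vector, and
  \<open>q\<close> inverts the pairing to write it down.\<close>

lemma psd_pt:
  assumes X: "psd T X"
  shows "psd D (pt X)"
proof (rule psdI)
  have "hermitian T X" using X by (simp add: psd_def)
  thus "hermitian D (pt X)" by (intro hermitianI) (simp_all add: hermitian_entry)
  fix f :: "nat \<Rightarrow> complex"
  define q where "q i = (THE ab. ab \<in> {..<D} \<times> {..<E} \<and> i = p (fst ab) (snd ab))" for i
  have q: "q (p a b) = (a,b)" if "a < D" "b < E" for a b
    unfolding q_def by (rule the_equality) (use that p_eq_iff in auto)
  define g where "g b i = (if snd (q i) = b then f (fst (q i)) else 0)" for b i
  have "(\<Sum>i<D. \<Sum>j<D. cnj (f i) * pt X $$ (i,j) * f j)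
     = (\<Sum>i<D. \<Sum>j<D. \<Sum>b<E. cnj (f i) * X $$ (p i b, p j b) * f j)"
    by (intro sum.cong refl) (simp add: sum_distrib_left sum_distrib_right)
  also have "\<dots> = (\<Sum>i<D. \<Sum>b<E. \<Sum>j<D. cnj (f i) * X $$ (p i b, p j b) * f j)"
    by (intro sum.cong refl sum.swap)
  also have "\<dots> = (\<Sum>b<E. \<Sum>i<D. \<Sum>j<D. cnj (f i) * X $$ (p i b, p j b) * f j)"
    by (rule sum.swap)
  also have "\<dots> = (\<Sum>b<E. \<Sum>k<T. \<Sum>l<T. cnj (g b k) * X $$ (k, l) * g b l)"
  proof (rule sum.cong[OF refl])
    fix b assume "b \<in> {..<E}"
    hence b: "b < E" by simp
    have "(\<Sum>k<T. \<Sum>l<T. cnj (g b k) * X $$ (k, l) * g b l)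
       = (\<Sum>i<D. \<Sum>c<E. \<Sum>j<D. \<Sum>c'<E. if c' = b then if c = b then cnj (f i) * X $$ (p i b, p j b) * f j else 0 else 0)"
      unfolding sum_pair by (intro sum.cong refl) (auto simp: g_def q)
    also have "\<dots> = (\<Sum>i<D. \<Sum>c<E. if c = b then \<Sum>j<D. cnj (f i) * X $$ (p i b, p j b) * f j else 0)"
      using b by (intro sum.cong refl) auto
    also have "\<dots> = (\<Sum>i<D. \<Sum>j<D. cnj (f i) * X $$ (p i b, p j b) * f j)"
      using b by simp
    finally show "(\<Sum>i<D. \<Sum>j<D. cnj (f i) * X $$ (p i b, p j b) * f j)
       = (\<Sum>k<T. \<Sum>l<T. cnj (g b k) * X $$ (k, l) * g b l)" ..
  qed
  finally show "0 \<le> Re (\<Sum>i<D. \<Sum>j<D. cnj (f i) * pt X $$ (i,j) * f j)"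
    using psdD[OF X] by (simp add: sum_nonneg)
qed

text \<open>\<open>acts2 U u\<close> says that \<open>U\<close> is the identity on the first factor tensored with \<open>u\<close> on the second,
  and \<open>acts1 U u\<close> the same with the factors exchanged.\<close>

definition acts1 :: "complex mat \<Rightarrow> complex mat \<Rightarrow> bool" where
  "acts1 U u \<longleftrightarrow> U \<in> carrier_mat T T \<and> (\<forall>a<D. \<forall>b<E. \<forall>a'<D. \<forall>b'<E.
     U $$ (p a b, p a' b') = (if b = b' then u $$ (a,a') else 0))"

definition acts2 :: "complex mat \<Rightarrow> complex mat \<Rightarrow> bool" where
  "acts2 U u \<longleftrightarrow> U \<in> carrier_mat T T \<and> (\<forall>a<D. \<forall>b<E. \<forall>a'<D. \<forall>b'<E.
     U $$ (p a b, p a' b') = (if a = a' then u $$ (b,b') else 0))"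

lemma unitary_acts2:
  assumes U: "acts2 U u" and u: "unitary E u"
  shows "unitary T U"
proof (rule unitaryI)
  show Uc: "U \<in> carrier_mat T T" using U by (simp add: acts2_def)
  show "adj U * U = 1\<^sub>m T"
  proof (rule eq_matI)
    fix i j assume "i < dim_row (1\<^sub>m T :: complex mat)" "j < dim_col (1\<^sub>m T :: complex mat)"
    hence "i < T" "j < T" by auto
    then obtain a b a' b' where i: "i = p a b" "a < D" "b < E" and j: "j = p a' b'" "a' < D" "b' < E"
      by (metis p_cases)
    have "(adj U * U) $$ (i,j) = (\<Sum>l<T. cnj (U $$ (l,i)) * U $$ (l,j))"
      using Uc i j by (subst index_mult_sum[of _ T T _ T]) (auto intro!: sum.cong)
    also have "\<dots> = (\<Sum>c<D. \<Sum>d<E. if c = a then if a = a' then cnj (u $$ (d,b)) * u $$ (d,b') else 0 else 0)"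
      unfolding sum_pair i(1) j(1) using U i j by (intro sum.cong refl) (auto simp: acts2_def)
    also have "\<dots> = (\<Sum>c<D. if c = a then if a = a' then \<Sum>d<E. cnj (u $$ (d,b)) * u $$ (d,b') else 0 else 0)"
      by (intro sum.cong refl) auto
    also have "\<dots> = (if a = a' then if b = b' then 1 else 0 else 0)"
      using i j unitary_cols[OF u i(3) j(3)] by simp
    also have "\<dots> = 1\<^sub>m T $$ (i,j)" using i j by (simp add: p_eq_iff)
    finally show "(adj U * U) $$ (i,j) = 1\<^sub>m T $$ (i,j)" .
  qed (use Uc in auto)
qed

lemma index_acts2_conj:
  assumes U: "acts2 U u" and X: "X \<in> carrier_mat T T" and ab: "a < D" "b < E" "a' < D" "b' < E"
  shows "(U * X * adj U) $$ (p a b, p a' b')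
     = (\<Sum>d<E. \<Sum>d'<E. u $$ (b,d) * X $$ (p a d, p a' d') * cnj (u $$ (b',d')))"
proof -
  have Uc: "U \<in> carrier_mat T T" using U by (simp add: acts2_def)
  have "(U * X * adj U) $$ (p a b, p a' b')
     = (\<Sum>k<T. \<Sum>l<T. U $$ (p a b,k) * X $$ (k,l) * cnj (U $$ (p a' b',l)))"
    using ab by (intro index_conj[OF Uc X]) auto
  also have "\<dots> = (\<Sum>c<D. \<Sum>d<E. \<Sum>c'<D. \<Sum>d'<E.
      if c' = a' then if c = a then u $$ (b,d) * X $$ (p a d, p a' d') * cnj (u $$ (b',d')) else 0 else 0)"
    unfolding sum_pair using U ab by (intro sum.cong refl) (auto simp: acts2_def)
  also have "\<dots> = (\<Sum>c<D. \<Sum>d<E. \<Sum>c'<D.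
      if c' = a' then if c = a then \<Sum>d'<E. u $$ (b,d) * X $$ (p a d, p a' d') * cnj (u $$ (b',d')) else 0 else 0)"
    by (intro sum.cong refl) auto
  also have "\<dots> = (\<Sum>c<D. \<Sum>d<E.
      if c = a then \<Sum>d'<E. u $$ (b,d) * X $$ (p a d, p a' d') * cnj (u $$ (b',d')) else 0)"
    using ab by (intro sum.cong refl) simp
  also have "\<dots> = (\<Sum>c<D.
      if c = a then \<Sum>d<E. \<Sum>d'<E. u $$ (b,d) * X $$ (p a d, p a' d') * cnj (u $$ (b',d')) else 0)"
    by (intro sum.cong refl) auto
  finally show ?thesis using ab by simp
qed

text \<open>Summing over the traced-out index meets two columns of \<open>u\<close>, and their
  orthonormality removes \<open>u\<close>.\<close>

lemma pt_acts2:
  assumes U: "acts2 U u" and u: "unitary E u" and X: "X \<in> carrier_mat T T"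
  shows "pt (U * X * adj U) = pt X"
proof (rule eq_matI)
  fix a a' assume "a < dim_row (pt X)" "a' < dim_col (pt X)"
  hence a: "a < D" "a' < D" by (auto simp: pt_def)
  have "pt (U * X * adj U) $$ (a,a')
     = (\<Sum>b<E. \<Sum>d<E. \<Sum>d'<E. u $$ (b,d) * X $$ (p a d, p a' d') * cnj (u $$ (b,d')))"
    using a by (simp add: index_acts2_conj[OF U X])
  also have "\<dots> = (\<Sum>d<E. \<Sum>b<E. \<Sum>d'<E. u $$ (b,d) * X $$ (p a d, p a' d') * cnj (u $$ (b,d')))"
    by (rule sum.swap)
  also have "\<dots> = (\<Sum>d<E. \<Sum>d'<E. \<Sum>b<E. u $$ (b,d) * X $$ (p a d, p a' d') * cnj (u $$ (b,d')))"
    by (intro sum.cong refl sum.swap)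
  also have "\<dots> = (\<Sum>d<E. \<Sum>d'<E. X $$ (p a d, p a' d') * (\<Sum>b<E. cnj (u $$ (b,d')) * u $$ (b,d)))"
    by (simp add: sum_distrib_left mult_ac)
  also have "\<dots> = (\<Sum>d<E. \<Sum>d'<E. if d' = d then X $$ (p a d, p a' d) else 0)"
    by (intro sum.cong refl) (auto simp: unitary_cols[OF u])
  also have "\<dots> = pt X $$ (a,a')" using a by simp
  finally show "pt (U * X * adj U) $$ (a,a') = pt X $$ (a,a')" .
qed (auto simp: pt_def)

lemma pairing_swap: "pairing E D T (\<lambda>b a. p a b)"
proof
  have "bij_betw prod.swap ({..<E} \<times> {..<D}) ({..<D} \<times> {..<E})"
    by (intro bij_betwI[where g = prod.swap]) auto
  from bij_betw_trans[OF this bij]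
  have "bij_betw ((\<lambda>(a,b). p a b) \<circ> prod.swap) ({..<E} \<times> {..<D}) {..<T}" .
  moreover have "(\<lambda>(a,b). p a b) \<circ> prod.swap = (\<lambda>(b,a). p a b)" by auto
  ultimately show "bij_betw (\<lambda>(b,a). p a b) ({..<E} \<times> {..<D}) {..<T}" by simp
qed

lemma acts1_iff_swap: "acts1 U u \<longleftrightarrow> pairing.acts2 E D T (\<lambda>b a. p a b) U u"
  unfolding acts1_def pairing.acts2_def[OF pairing_swap] by blast

lemma unitary_acts1: "acts1 U u \<Longrightarrow> unitary D u \<Longrightarrow> unitary T U"
  unfolding acts1_iff_swap by (rule pairing.unitary_acts2[OF pairing_swap])

lemma pt_acts1:
  assumes U: "acts1 U u" and u: "u \<in> carrier_mat D D" and X: "X \<in> carrier_mat T T"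
  shows "pt (U * X * adj U) = u * pt X * adj u"
proof (rule eq_matI)
  fix a a' assume "a < dim_row (u * pt X * adj u)" "a' < dim_col (u * pt X * adj u)"
  hence a: "a < D" "a' < D" using u by auto
  have "pt (U * X * adj U) $$ (a,a')
     = (\<Sum>b<E. \<Sum>d<D. \<Sum>d'<D. u $$ (a,d) * X $$ (p d b, p d' b) * cnj (u $$ (a',d')))"
    using a pairing.index_acts2_conj[OF pairing_swap U[unfolded acts1_iff_swap] X]
    by (simp del: index_mult_mat)
  also have "\<dots> = (\<Sum>d<D. \<Sum>b<E. \<Sum>d'<D. u $$ (a,d) * X $$ (p d b, p d' b) * cnj (u $$ (a',d')))"
    by (rule sum.swap)
  also have "\<dots> = (\<Sum>d<D. \<Sum>d'<D. \<Sum>b<E. u $$ (a,d) * X $$ (p d b, p d' b) * cnj (u $$ (a',d')))"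
    by (intro sum.cong refl sum.swap)
  also have "\<dots> = (\<Sum>d<D. \<Sum>d'<D. u $$ (a,d) * pt X $$ (d,d') * cnj (u $$ (a',d')))"
    by (intro sum.cong refl) (simp add: sum_distrib_left sum_distrib_right)
  also have "\<dots> = (u * pt X * adj u) $$ (a,a')"
    by (rule index_conj[OF u pt_carrier a, symmetric])
  finally show "pt (U * X * adj U) $$ (a,a') = (u * pt X * adj u) $$ (a,a')" .
qed (use u in \<open>auto simp: pt_def\<close>)

end

section \<open>Cuts of the chain and embedded gates\<close>

lemma pairing_std: "pairing D E (D * E) (\<lambda>a b. a * E + b)"
proof
  have "a * E + b < D * E" if "a < D" "b < E" for a b
  proof -
    have "a * E + b < Suc a * E" using that by simp
    also have "\<dots> \<le> D * E" using that by (intro mult_le_mono1) simp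
    finally show ?thesis .
  qed
  thus "bij_betw (\<lambda>(a,b). a * E + b) ({..<D} \<times> {..<E}) {..<D * E}"
    by (intro bij_betwI[where g = "\<lambda>i. (i div E, i mod E)"])
      (auto simp: less_mult_imp_div_less mult.commute intro!: mod_less_divisor gr0I)
qed

lemma pairing_first:
  assumes "j \<le> n"
  shows "pairing (2^j) (2^(n-j)) (2^n) (\<lambda>a b. a * 2^(n-j) + b)"
  using pairing_std[of "2^j" "2^(n-j)"] assms by (simp flip: power_add)

lemma pairing_last:
  assumes "j \<le> n"
  shows "pairing (2^(n-j)) (2^j) (2^n) (\<lambda>b a. a * 2^(n-j) + b)"
  by (rule pairing.pairing_swap[OF pairing_first[OF assms]])

lemma red_first_pt: "j \<le> n \<Longrightarrow> red_first n j = pairing.pt (2^j) (2^(n-j)) (\<lambda>a b. a * 2^(n-j) + b)"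
  by (rule ext) (simp add: red_first_def pairing.pt_def[OF pairing_first])

lemma red_last_pt: "j \<le> n \<Longrightarrow> red_last n j = pairing.pt (2^(n-j)) (2^j) (\<lambda>b a. a * 2^(n-j) + b)"
  by (rule ext) (simp add: red_last_def pairing.pt_def[OF pairing_last])

lemma embed2_carrier[simp]: "embed2 n k V \<in> carrier_mat (2^n) (2^n)"
  by (simp add: embed2_def)

text \<open>A gate to the right of the cut, with its position counted from the cut. The block size
  \<open>2^(n-k-1)\<close> behind the gate is unchanged, and the left index only enters in the
  digits above the gate.\<close>

lemma embed2_acts2:
  assumes "j + 1 \<le> k" "k + 1 \<le> n"
  shows "pairing.acts2 (2^j) (2^(n-j)) (2^n) (\<lambda>a b. a * 2^(n-j) + b) (embed2 n k V) (embed2 (n-j) (k-j) V)"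
proof -
  have jn: "j \<le> n" using assms by simp
  interpret pairing "2^j" "2^(n-j)" "2^n" "\<lambda>a b. a * 2^(n-j) + b" by (rule pairing_first[OF jn])
  define h :: nat where "h = 2^(n-k-1)"
  \<comment> \<open>The number of strings of the qubits S_{j+1}, ..., S_{k-1} between the cut and
    the gate.\<close>
  define c :: nat where "c = 2^(k-1-j)"
  have h0: "h > 0" by (simp add: h_def)
  have nj: "n - j = (n - k - 1) + 2 + (k - 1 - j)" using assms by simp
  have E: "(2::nat)^(n-j) = 4 * h * c" unfolding nj power_add h_def c_def by simp
  have hh: "(2::nat)^(n - j - (k - j) - 1) = h" using assms by (simp add: h_def)
  show ?thesis unfolding acts2_def
  proof (intro conjI allI impI)
    fix a b a' b' :: nat
    assume ab: "a < 2^j" "b < 2^(n-j)" "a' < 2^j" "b' < 2^(n-j)"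
    have less: "a * 2^(n-j) + b < 2^n" "a' * 2^(n-j) + b' < 2^n" using ab by simp_all
    have d4: "(x * 2^(n-j) + y) div (4 * h) = x * c + y div (4 * h)" for x y
      unfolding E using h0 div_mult_self3[of "4 * h" "x * c" y] by (simp add: mult_ac)
    \<comment> \<open>The left index contributes a multiple of 4, which \<open>mod 4\<close>
      removes: the two gate digits come from \<open>y\<close> alone.\<close>
    have d1: "(x * 2^(n-j) + y) div h = y div h + (x * c) * 4" for x y
      unfolding E using h0 div_mult_self3[of h "4 * x * c" y] by (simp add: mult_ac)
    have m1: "(x * 2^(n-j) + y) mod h = y mod h" for x y
      unfolding E using mod_mult_self3[of "4 * x * c" h y] by (simp add: mult_ac)
    have bc: "b div (4 * h) < c" "b' div (4 * h) < c"
      using ab h0 unfolding E by (simp_all add: less_mult_imp_div_less mult_ac)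
    have eq: "a * c + b div (4 * h) = a' * c + b' div (4 * h) \<longleftrightarrow> a = a' \<and> b div (4 * h) = b' div (4 * h)"
    proof
      assume *: "a * c + b div (4 * h) = a' * c + b' div (4 * h)"
      from arg_cong[OF *, of "\<lambda>x. x div c"] arg_cong[OF *, of "\<lambda>x. x mod c"]
      show "a = a' \<and> b div (4 * h) = b' div (4 * h)" using bc by simp
    qed simp
    show "embed2 n k V $$ (a * 2^(n-j) + b, a' * 2^(n-j) + b')
       = (if a = a' then embed2 (n-j) (k-j) V $$ (b,b') else 0)"
      using ab less unfolding embed2_def Let_def hh h_def[symmetric]
      by (simp add: d4 d1 m1 eq del: div_mult_self1 div_mult_self2 div_mult_self3 div_mult_self4)
  qed simp
qed

text \<open>A gate to the left of the cut. The right index consists of the lowest digits, all behind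
  the gate, so equality of the digits behind the gate splits into \<open>b = b'\<close> and equality
  of those that remain on the left.\<close>

lemma embed2_acts1:
  assumes "1 \<le> k" "k + 1 \<le> j" "j \<le> n"
  shows "pairing.acts1 (2^j) (2^(n-j)) (2^n) (\<lambda>a b. a * 2^(n-j) + b) (embed2 n k V) (embed2 j k V)"
proof -
  interpret pairing "2^j" "2^(n-j)" "2^n" "\<lambda>a b. a * 2^(n-j) + b" by (rule pairing_first[OF assms(3)])
  define h :: nat where "h = 2^(j-k-1)"
  define F :: nat where "F = 2^(n-j)"
  have F0: "F > 0" by (simp add: F_def)
  have nk: "n - k - 1 = (n - j) + (j - k - 1)" using assms by simp
  have H: "(2::nat)^(n-k-1) = F * h" unfolding nk power_add h_def F_def by simp
  show ?thesis unfolding acts1_def unfolding F_def[symmetric]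
  proof (intro conjI allI impI)
    fix a b a' b' :: nat
    assume ab: "a < 2^j" "b < F" "a' < 2^j" "b' < F"
    have less: "a * F + b < 2^n" "a' * F + b' < 2^n" using ab unfolding F_def by simp_all
    have d: "(x * F + y) div (F * z) = x div z" if "y < F" for x y z
      using that by (simp add: div_mult2_eq)
    have d4: "(x * F + y) div (4 * (F * h)) = x div (4 * h)" if "y < F" for x y
      using d[OF that, of x "4 * h"] by (simp add: mult_ac)
    have m: "(x * F + y) mod (F * h) = F * (x mod h) + y" if "y < F" for x y
      using that by (simp add: mod_mult2_eq)
    have eq: "F * (a mod h) + b = F * (a' mod h) + b' \<longleftrightarrow> a mod h = a' mod h \<and> b = b'"
    proof
      assume *: "F * (a mod h) + b = F * (a' mod h) + b'"
      from arg_cong[OF *, of "\<lambda>x. x div F"] arg_cong[OF *, of "\<lambda>x. x mod F"]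
      show "a mod h = a' mod h \<and> b = b'" using ab by simp
    qed simp
    show "embed2 n k V $$ (a * F + b, a' * F + b') = (if b = b' then embed2 j k V $$ (a,a') else 0)"
      using ab less unfolding embed2_def Let_def H h_def[symmetric]
      by (auto simp: d d4 m eq)
  qed simp
qed

lemma embed2_2_1:
  assumes "V \<in> carrier_mat 4 4"
  shows "embed2 2 1 V = V"
  using assms by (intro eq_matI) (auto simp: embed2_def)

text \<open>Removing the k-1 qubits in front of the gate and then those behind it leaves
  \<open>V\<close> on a two-qubit chain; both removals reflect unitarity.\<close>

lemma unitary_embed2:
  assumes V: "unitary 4 V" and k: "1 \<le> k" "k + 1 \<le> n"
  shows "unitary (2^n) (embed2 n k V)"
proof -
  have "unitary (2^2) (embed2 2 1 V)" using V embed2_2_1[OF unitary_carrier[OF V]] by simp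
  moreover have j: "2 \<le> n - (k - 1)" "k - 1 \<le> n" using k by auto
  moreover have "pairing.acts1 (2^2) (2^(n-(k-1)-2)) (2^(n-(k-1))) (\<lambda>a b. a * 2^(n-(k-1)-2) + b)
      (embed2 (n-(k-1)) 1 V) (embed2 2 1 V)"
    using j by (intro embed2_acts1) auto
  ultimately have "unitary (2^(n-(k-1))) (embed2 (n-(k-1)) 1 V)"
    by (metis pairing.unitary_acts1[OF pairing_first[OF j(1)]])
  moreover have "k - (k - 1) = 1" using k by simp
  ultimately have "unitary (2^(n-(k-1))) (embed2 (n-(k-1)) (k-(k-1)) V)" by simp
  moreover have "pairing.acts2 (2^(k-1)) (2^(n-(k-1))) (2^n) (\<lambda>a b. a * 2^(n-(k-1)) + b)
      (embed2 n k V) (embed2 (n-(k-1)) (k-(k-1)) V)"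
    using k by (intro embed2_acts2) auto
  ultimately show ?thesis
    by (rule pairing.unitary_acts2[OF pairing_first[OF j(2)], rotated])
qed

lemma mutual_info_embed2:
  assumes V: "unitary 4 V" and k: "1 \<le> k" "k + 1 \<le> n" and j: "j \<le> n" "j \<noteq> k" and X: "psd (2^n) X"
  shows "mutual_info n j (embed2 n k V * X * adj (embed2 n k V)) = mutual_info n j X"
proof -
  define U where "U = embed2 n k V"
  have Xc: "X \<in> carrier_mat (2^n) (2^n)" using X by (rule psd_carrier)
  have whole: "vn_entropy (U * X * adj U) = vn_entropy X"
    unfolding U_def by (rule vn_entropy_unitary_conj[OF unitary_embed2[OF V k] X])
  note pf = pairing_first[OF j(1)] and pl = pairing_last[OF j(1)]
  show ?thesis
  proof (cases "j < k")
    case True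
    have u: "unitary (2^(n-j)) (embed2 (n-j) (k-j) V)" using True k by (intro unitary_embed2 V) auto
    have U: "pairing.acts2 (2^j) (2^(n-j)) (2^n) (\<lambda>a b. a * 2^(n-j) + b) U (embed2 (n-j) (k-j) V)"
      unfolding U_def using True k by (intro embed2_acts2) auto
    hence U': "pairing.acts1 (2^(n-j)) (2^j) (2^n) (\<lambda>b a. a * 2^(n-j) + b) U (embed2 (n-j) (k-j) V)"
      by (simp only: pairing.acts1_iff_swap[OF pl])
    have "red_first n j (U * X * adj U) = red_first n j X"
      unfolding red_first_pt[OF j(1)] by (rule pairing.pt_acts2[OF pf U u Xc])
    moreover have "vn_entropy (red_last n j (U * X * adj U)) = vn_entropy (red_last n j X)"
      unfolding red_last_pt[OF j(1)] pairing.pt_acts1[OF pl U' unitary_carrier[OF u] Xc]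
      by (rule vn_entropy_unitary_conj[OF u pairing.psd_pt[OF pl X]])
    ultimately show ?thesis using whole by (simp add: mutual_info_def U_def)
  next
    case False
    hence jk: "k + 1 \<le> j" using j by simp
    have u: "unitary (2^j) (embed2 j k V)" using jk k by (intro unitary_embed2 V) auto
    have U: "pairing.acts1 (2^j) (2^(n-j)) (2^n) (\<lambda>a b. a * 2^(n-j) + b) U (embed2 j k V)"
      unfolding U_def using jk k j by (intro embed2_acts1) auto
    hence U': "pairing.acts2 (2^(n-j)) (2^j) (2^n) (\<lambda>b a. a * 2^(n-j) + b) U (embed2 j k V)"
      by (simp only: pairing.acts1_iff_swap[OF pf])
    have "red_last n j (U * X * adj U) = red_last n j X"
      unfolding red_last_pt[OF j(1)] by (rule pairing.pt_acts2[OF pl U' u Xc])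
    moreover have "vn_entropy (red_first n j (U * X * adj U)) = vn_entropy (red_first n j X)"
      unfolding red_first_pt[OF j(1)] pairing.pt_acts1[OF pf U unitary_carrier[OF u] Xc]
      by (rule vn_entropy_unitary_conj[OF u pairing.psd_pt[OF pf X]])
    ultimately show ?thesis using whole by (simp add: mutual_info_def U_def)
  qed
qed

text \<open>The cut at k-1 lies just before the gate. For k = 1 the reduced state is the 1 x 1
  matrix holding the trace, so the end of the chain is no special case.\<close>

lemma red_first_embed2:
  assumes V: "unitary 4 V" and k: "1 \<le> k" "k + 1 \<le> n" and X: "X \<in> carrier_mat (2^n) (2^n)"
  shows "red_first n (k-1) (embed2 n k V * X * adj (embed2 n k V)) = red_first n (k-1) X"
proof -
  have j: "k - 1 \<le> n" using k by simp
  have u: "unitary (2^(n-(k-1))) (embed2 (n-(k-1)) (k-(k-1)) V)" using k by (intro unitary_embed2 V) auto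
  have U: "pairing.acts2 (2^(k-1)) (2^(n-(k-1))) (2^n) (\<lambda>a b. a * 2^(n-(k-1)) + b) (embed2 n k V) (embed2 (n-(k-1)) (k-(k-1)) V)"
    using k by (intro embed2_acts2) auto
  show ?thesis unfolding red_first_pt[OF j] by (rule pairing.pt_acts2[OF pairing_first[OF j] U u X])
qed

text \<open>The cut at k+1 lies just behind the gate; for k + 1 = n the reduced state is again 1 x
  1.\<close>

lemma red_last_embed2:
  assumes V: "unitary 4 V" and k: "1 \<le> k" "k + 1 \<le> n" and X: "X \<in> carrier_mat (2^n) (2^n)"
  shows "red_last n (k+1) (embed2 n k V * X * adj (embed2 n k V)) = red_last n (k+1) X"
proof -
  note pf = pairing_first[OF k(2)] and pl = pairing_last[OF k(2)]
  have u: "unitary (2^(k+1)) (embed2 (k+1) k V)" using k by (intro unitary_embed2 V) auto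
  have "pairing.acts1 (2^(k+1)) (2^(n-(k+1))) (2^n) (\<lambda>a b. a * 2^(n-(k+1)) + b) (embed2 n k V) (embed2 (k+1) k V)"
    using k by (intro embed2_acts1) auto
  hence "pairing.acts2 (2^(n-(k+1))) (2^(k+1)) (2^n) (\<lambda>b a. a * 2^(n-(k+1)) + b) (embed2 n k V) (embed2 (k+1) k V)"
    by (simp only: pairing.acts1_iff_swap[OF pf])
  thus ?thesis unfolding red_last_pt[OF k(2)] by (rule pairing.pt_acts2[OF pl _ u X])
qed

lemma qubit_split_last: "qubit_split m (\<lambda>s a. 2 * a + of_bool s) odd (\<lambda>i. i div 2)"
  by unfold_locales auto

lemma qubit_split_first: "qubit_split m (\<lambda>s b. of_bool s * m + b) (\<lambda>i. m \<le> i) (\<lambda>i. i mod m)"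
  by unfold_locales (auto simp: mod_if)

lemma marg_red_first:
  assumes k: "1 \<le> k" "k \<le> n"
  shows "qubit_split.marg (2^(k-1)) (\<lambda>s a. 2 * a + of_bool s) (red_first n k X) = red_first n (k-1) X"
proof -
  obtain j where j: "k = Suc j" using k by (cases k) auto
  define M :: nat where "M = 2^j"
  define F :: nat where "F = 2^(n - Suc j)"
  interpret qubit_split M "\<lambda>s a. 2 * a + of_bool s" odd "\<lambda>i. i div 2" by (rule qubit_split_last)
  have "n - j = Suc (n - Suc j)" using k j by simp
  hence E: "(2::nat)^(n-j) = 2 * F" by (simp add: F_def)
  have D: "(2::nat)^Suc j = 2 * M" by (simp add: M_def)
  \<comment> \<open>The traced-out strings of S_k, ..., S_n are sorted by their leading bit, the
    value of S_k.\<close>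
  have split: "(\<Sum>b<2 * F. g b) = (\<Sum>b<F. g b) + (\<Sum>b<F. g (F + b))" for g :: "nat \<Rightarrow> complex"
    using qubit_split.sum_split[OF qubit_split_first[of F], of g] by simp
  have "marg (red_first n (Suc j) X) = red_first n j X"
    unfolding marg_def block_def red_first_def E D M_def[symmetric] F_def[symmetric] split
    by (rule eq_matI) (auto simp: sum.distrib algebra_simps)
  thus ?thesis by (simp add: j M_def)
qed

lemma marg_red_last:
  assumes k: "k + 1 \<le> n"
  shows "qubit_split.marg (2^(n-k-1)) (\<lambda>s b. of_bool s * 2^(n-k-1) + b) (red_last n k X) = red_last n (k+1) X"
proof -
  define m :: nat where "m = 2^(n-k-1)"
  define M :: nat where "M = 2^k"
  interpret qubit_split m "\<lambda>s b. of_bool s * m + b" "\<lambda>i. m \<le> i" "\<lambda>i. i mod m" by (rule qubit_split_first)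
  have "n - k = Suc (n - k - 1)" using k by simp
  hence E: "(2::nat)^(n-k) = 2 * m" unfolding m_def by (metis power_Suc)
  have D: "(2::nat)^(n - (k + 1)) = m" by (simp add: m_def)
  have K: "(2::nat)^(k + 1) = 2 * M" by (simp add: M_def)
  \<comment> \<open>Here S_{k+1} is the lowest bit of the traced-out strings, so they are sorted by
    parity.\<close>
  have split: "(\<Sum>a<2 * M. g a) = (\<Sum>a<M. g (2 * a)) + (\<Sum>a<M. g (2 * a + 1))" for g :: "nat \<Rightarrow> complex"
    using qubit_split.sum_split[OF qubit_split_last[of M], of g] by simp
  have "marg (red_last n k X) = red_last n (k+1) X"
    unfolding marg_def block_def red_last_def E D K M_def[symmetric] split
    by (rule eq_matI) (auto simp: sum.distrib algebra_simps)
  thus ?thesis by (simp only: m_def)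
qed

section \<open>Gate cost and trace distance\<close>

lemma pow_spectral:
  assumes Q: "unitary d Q" and A: "A = Q * diagm d f * adj Q"
  shows "A ^\<^sub>m k = Q * diagm d (\<lambda>i. f i ^ k) * adj Q"
proof (induction k)
  case 0
  have "diagm d (\<lambda>i. f i ^ 0) = 1\<^sub>m d" by (intro eq_matI) auto
  thus ?case using Q A by (auto simp: unitary_def)
next
  case (Suc k)
  have Qc: "Q \<in> carrier_mat d d" "adj Q * Q = 1\<^sub>m d" using Q by (auto simp: unitary_def)
  note as = assoc_mult_mat[of _ d d _ d _ d]
  have 1: "adj Q * (Q * X) = X" if "X \<in> carrier_mat d d" for X
    using that Qc by (simp flip: as)
  have "A ^\<^sub>m Suc k = Q * (diagm d (\<lambda>i. f i ^ k) * diagm d f) * adj Q"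
    unfolding pow_mat.simps Suc unfolding A using Qc by (simp add: as 1)
  thus ?case by (simp add: diagm_mult mult.commute)
qed

text \<open>In an eigenbasis each entrywise series is a finite combination of scalar exponential
  series, which also settles its convergence.\<close>

lemma mat_exp_spectral:
  assumes Q: "unitary d Q" and A: "A = Q * diagm d f * adj Q"
  shows "mat_exp A = Q * diagm d (\<lambda>i. exp (f i)) * adj Q"
proof (rule eq_matI)
  have Qc: "Q \<in> carrier_mat d d" using Q by (rule unitary_carrier)
  have d: "dim_row A = d" using A Qc by simp
  fix i j assume "i < dim_row (Q * diagm d (\<lambda>i. exp (f i)) * adj Q)" "j < dim_col (Q * diagm d (\<lambda>i. exp (f i)) * adj Q)"
  hence ij: "i < d" "j < d" using Qc by auto
  have "(\<lambda>k. \<Sum>m<d. Q $$ (i,m) * (f m ^ k /\<^sub>R fact k) * cnj (Q $$ (j,m))) sums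
      (\<Sum>m<d. Q $$ (i,m) * exp (f m) * cnj (Q $$ (j,m)))"
    by (intro sums_sum sums_mult sums_mult2 exp_converges)
  moreover have "(\<Sum>m<d. Q $$ (i,m) * (f m ^ k /\<^sub>R fact k) * cnj (Q $$ (j,m))) = (A ^\<^sub>m k) $$ (i,j) / of_nat (fact k)" for k
    unfolding pow_spectral[OF Q A] index_conj_diag[OF Qc ij] sum_divide_distrib
    by (intro sum.cong refl) (simp add: scaleR_conv_of_real field_simps)
  ultimately have "(\<lambda>k. (A ^\<^sub>m k) $$ (i,j) / of_nat (fact k)) sums (\<Sum>m<d. Q $$ (i,m) * exp (f m) * cnj (Q $$ (j,m)))"
    by simp
  thus "mat_exp A $$ (i,j) = (Q * diagm d (\<lambda>i. exp (f i)) * adj Q) $$ (i,j)"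
    unfolding index_conj_diag[OF Qc ij] using ij d by (simp add: mat_exp_def sums_iff)
qed (use A unitary_carrier[OF Q] in \<open>auto simp: mat_exp_def\<close>)

lemma smult_spectral:
  assumes "Q \<in> carrier_mat d d"
  shows "c \<cdot>\<^sub>m (Q * diagm d f * adj Q) = Q * diagm d (\<lambda>i. c * f i) * adj Q"
proof (rule eq_matI)
  fix i j assume "i < dim_row (Q * diagm d (\<lambda>i. c * f i) * adj Q)" "j < dim_col (Q * diagm d (\<lambda>i. c * f i) * adj Q)"
  hence ij: "i < d" "j < d" using assms by auto
  have "(c \<cdot>\<^sub>m (Q * diagm d f * adj Q)) $$ (i,j) = c * (Q * diagm d f * adj Q) $$ (i,j)"
    using ij assms by simp
  thus "(c \<cdot>\<^sub>m (Q * diagm d f * adj Q)) $$ (i,j) = (Q * diagm d (\<lambda>i. c * f i) * adj Q) $$ (i,j)"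
    unfolding index_conj_diag[OF assms ij] by (simp add: sum_distrib_left mult_ac)
qed (use assms in auto)

lemma mat_exp_hermitian:
  assumes Q: "unitary d Q" and H: "H = Q * diagm d (\<lambda>i. complex_of_real (l i)) * adj Q"
  shows "mat_exp ((- \<i>) \<cdot>\<^sub>m H) = Q * diagm d (\<lambda>i. cis (- l i)) * adj Q"
  using mat_exp_spectral[OF Q smult_spectral[OF unitary_carrier[OF Q], of "-\<i>" "\<lambda>i. complex_of_real (l i)"]]
  by (simp add: H cis_conv_exp)

text \<open>A real supremum bounds its elements only when the set is bounded; the row sums of the
  moduli give a crude bound, as a unit vector has coordinates of modulus at most 1.\<close>

lemma bdd_above_opnorm:
  assumes A: "A \<in> carrier_mat d d"
  shows "bdd_above {vnorm (A *\<^sub>v v) | v. v \<in> carrier_vec (dim_col A) \<and> vnorm v = 1}"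
proof -
  define C where "C = sqrt (\<Sum>i<d. (\<Sum>j<d. cmod (A $$ (i,j)))\<^sup>2)"
  have "vnorm (A *\<^sub>v v) \<le> C" if v: "v \<in> carrier_vec d" "vnorm v = 1" for v
  proof -
    have vj: "cmod (v $ j) \<le> 1" if "j < d" for j
    proof -
      have "(cmod (v $ j))\<^sup>2 \<le> (\<Sum>j<d. (cmod (v $ j))\<^sup>2)" using that by (intro member_le_sum) auto
      also have "\<dots> = 1" using v by (simp add: vnorm_def)
      finally show ?thesis by (simp add: power_le_one_iff abs_square_le_1)
    qed
    have "cmod ((A *\<^sub>v v) $ i) \<le> (\<Sum>j<d. cmod (A $$ (i,j)))" if i: "i < d" for i
    proof -
      have "(A *\<^sub>v v) $ i = (\<Sum>j<d. A $$ (i,j) * v $ j)"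
        using A v i by (auto simp: scalar_prod_def atLeast0LessThan intro!: sum.cong)
      also have "cmod \<dots> \<le> (\<Sum>j<d. cmod (A $$ (i,j) * v $ j))" by (rule norm_sum)
      also have "\<dots> \<le> (\<Sum>j<d. cmod (A $$ (i,j)))"
        using vj by (intro sum_mono) (auto simp: norm_mult mult_left_le)
      finally show ?thesis .
    qed
    thus ?thesis unfolding vnorm_def C_def using A
      by (intro real_sqrt_le_mono) (auto intro!: sum_mono power_mono)
  qed
  thus ?thesis using A by (intro bdd_aboveI[of _ C]) auto
qed

lemma eigenvalue_le_opnorm:
  assumes Q: "unitary d Q" and H: "H = Q * diagm d (\<lambda>i. complex_of_real (l i)) * adj Q" and i: "i < d"
  shows "\<bar>l i\<bar> \<le> opnorm H"
proof -
  have Qc: "Q \<in> carrier_mat d d" "adj Q * Q = 1\<^sub>m d" using Q by (auto simp: unitary_def)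
  have Hc: "H \<in> carrier_mat d d" using H Qc by simp
  define v where "v = col Q i"
  have v: "v \<in> carrier_vec d" using Qc by (auto simp: v_def intro!: carrier_vecI)
  have v1: "vnorm v = 1"
    using unitary_col_norm[OF Q i] Qc i by (simp add: vnorm_def v_def)
  have "H * Q = Q * diagm d (\<lambda>i. complex_of_real (l i))"
    unfolding H using Qc by (simp add: assoc_mult_mat[of _ d d _ d _ d])
  hence "H *\<^sub>v v = col (Q * diagm d (\<lambda>i. complex_of_real (l i))) i"
    unfolding v_def using Hc Qc i by (metis col_mult2)
  also have "\<dots> = complex_of_real (l i) \<cdot>\<^sub>v v"
  proof (rule eq_vecI)
    fix k assume "k < dim_vec (complex_of_real (l i) \<cdot>\<^sub>v v)"
    hence k: "k < d" using v by simp
    have "(Q * diagm d (\<lambda>i. complex_of_real (l i))) $$ (k,i) = (\<Sum>m<d. if m = i then complex_of_real (l i) * Q $$ (k,i) else 0)"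
      unfolding index_mult_sum[OF Qc(1) diagm_carrier k i] using i by (intro sum.cong) auto
    thus "col (Q * diagm d (\<lambda>i. complex_of_real (l i))) i $ k = (complex_of_real (l i) \<cdot>\<^sub>v v) $ k"
      using k i Qc by (simp add: v_def del: index_mult_mat(1))
  qed (use Qc v in auto)
  finally have "vnorm (H *\<^sub>v v) = sqrt (\<Sum>k<d. (l i)\<^sup>2 * (cmod (v $ k))\<^sup>2)"
    using v by (simp add: vnorm_def norm_mult power_mult_distrib)
  also have "\<dots> = \<bar>l i\<bar> * vnorm v"
    using v by (simp add: vnorm_def real_sqrt_mult flip: sum_distrib_left)
  finally have "vnorm (H *\<^sub>v v) = \<bar>l i\<bar>" using v1 by simp
  thus ?thesis unfolding opnorm_def
    using v v1 Hc by (intro cSup_upper bdd_above_opnorm[OF Hc]) force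
qed

definition gate_logs :: "complex mat \<Rightarrow> complex mat set" where
  "gate_logs U = {H. hermitian (dim_row U) H \<and>
      (\<exists>\<chi>::real. mat_exp ((- \<i>) \<cdot>\<^sub>m H) = exp (- \<i> * complex_of_real \<chi>) \<cdot>\<^sub>m U)}"

lemma gate_cost_eq: "gate_cost U = Inf (opnorm ` gate_logs U)"
  unfolding gate_cost_def gate_logs_def by (rule arg_cong[where f = Inf]) auto

text \<open>Guarantees that the infimum in \<open>gate_cost\<close> is over a nonempty set. The
  witness takes the principal arguments of the eigenvalues of \<open>U\<close>, negated because of
  the exponent -iH, with \<chi> = 0.\<close>

lemma gate_logs_nonempty:
  assumes U: "unitary d U"
  shows "gate_logs U \<noteq> {}"
proof -
  have Uc: "U \<in> carrier_mat d d" and UU: "U * adj U = 1\<^sub>m d" "adj U * U = 1\<^sub>m d" using U by (auto simp: unitary_def)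
  obtain Q f where Q: "unitary d Q" "U = Q * diagm d f * adj Q"
    using normal_spectral[OF Uc] UU by auto
  have Qc: "Q \<in> carrier_mat d d" using Q by (simp add: unitary_def)
  have "unitary d (adj Q * U * Q)" using Q U by (intro unitary_mult unitary_adj)
  hence uD: "unitary d (diagm d f)" using unitary_conj_cancel(1)[OF Q(1) diagm_carrier[of d f]] Q(2) by simp
  have f1: "cmod (f i) = 1" if i: "i < d" for i
  proof -
    have "(\<Sum>k<d. (cmod (diagm d f $$ (k,i)))\<^sup>2) = (\<Sum>k<d. if k = i then (cmod (f i))\<^sup>2 else 0)"
      using i by (intro sum.cong) auto
    hence "(cmod (f i))\<^sup>2 = 1" using unitary_col_norm[OF uD i] i by simp
    thus ?thesis by (simp add: power2_eq_1_iff) (use norm_ge_zero[of "f i"] in linarith)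
  qed
  define l where "l i = - Arg (f i)" for i
  define H where "H = Q * diagm d (\<lambda>i. complex_of_real (l i)) * adj Q"
  have "cis (- l i) = f i" if "i < d" for i
  proof -
    have "f i \<noteq> 0" using f1[OF that] by auto
    thus ?thesis using f1[OF that] cis_Arg[of "f i"] by (simp add: l_def sgn_div_norm)
  qed
  hence "diagm d (\<lambda>i. cis (- l i)) = diagm d f" by (intro eq_matI) auto
  hence "mat_exp ((- \<i>) \<cdot>\<^sub>m H) = U" using mat_exp_hermitian[OF Q(1) H_def] Q(2) by simp
  hence "mat_exp ((- \<i>) \<cdot>\<^sub>m H) = exp (- \<i> * complex_of_real 0) \<cdot>\<^sub>m U" by (auto intro!: eq_matI)
  moreover have "hermitian d H"
    unfolding hermitian_def H_def using Qc
    by (simp add: adj_mult[of _ d d _ d] adj_diagm assoc_mult_mat[of _ d d _ d _ d])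
  ultimately show ?thesis using Uc unfolding gate_logs_def by blast
qed

text \<open>Some eigenvalue modulus lies below the norm. In dimension 0 there is no unit vector, and
  the supremum would be over the empty set.\<close>

lemma opnorm_nonneg:
  assumes H: "hermitian d H" and d: "0 < d"
  shows "0 \<le> opnorm H"
proof -
  obtain Q l where "unitary d Q" "H = Q * diagm d (\<lambda>i. complex_of_real (l i)) * adj Q"
    using hermitian_spectral[OF H] by blast
  thus ?thesis using eigenvalue_le_opnorm[OF _ _ d] by fastforce
qed

lemma gate_cost_nonneg:
  assumes U: "unitary d U" and d: "0 < d"
  shows "0 \<le> gate_cost U"
proof -
  have "dim_row U = d" using U by (auto simp: unitary_def)
  thus ?thesis unfolding gate_cost_eq using gate_logs_nonempty[OF U] d
    by (intro cInf_greatest) (auto simp: gate_logs_def intro: opnorm_nonneg)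
qed

text \<open>A nearly optimal Hamiltonian, in spectral form; \<open>z\<close> is its global phase,
  which conjugation does not see.\<close>

lemma gate_cost_less:
  assumes U: "unitary d U" and t: "gate_cost U < t"
  shows "\<exists>Q l z. unitary d Q \<and> (\<forall>i<d. \<bar>l i\<bar> \<le> t) \<and> cmod z = 1
     \<and> z \<cdot>\<^sub>m U = Q * diagm d (\<lambda>i. cis (- l i)) * adj Q"
proof -
  have dU: "dim_row U = d" using U by (auto simp: unitary_def)
  obtain H where H: "H \<in> gate_logs U" "opnorm H < t"
    using t gate_logs_nonempty[OF U] unfolding gate_cost_eq by (auto dest!: cInf_lessD[rotated])
  then obtain \<chi> :: real where h: "hermitian d H"
      and e: "mat_exp ((- \<i>) \<cdot>\<^sub>m H) = exp (- \<i> * complex_of_real \<chi>) \<cdot>\<^sub>m U"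
    by (auto simp: gate_logs_def dU)
  obtain Q l where Q: "unitary d Q" "H = Q * diagm d (\<lambda>i. complex_of_real (l i)) * adj Q"
    using hermitian_spectral[OF h] by blast
  have "\<forall>i<d. \<bar>l i\<bar> \<le> t" using eigenvalue_le_opnorm[OF Q] H(2) by fastforce
  moreover have "cmod (exp (- \<i> * complex_of_real \<chi>)) = 1" by simp
  ultimately show ?thesis using Q(1) mat_exp_hermitian[OF Q] e by metis
qed

text \<open>The real part of the trace is the average of cos (l_i) with the probabilities <q_i,
  \<rho> q_i>, and cosine is at least cos t on [-t, t].\<close>

lemma Re_tr_mult_ge_cos:
  assumes Q: "unitary d Q" and W: "W = Q * diagm d (\<lambda>i. cis (- l i)) * adj Q"
    and l: "\<forall>i<d. \<bar>l i\<bar> \<le> t" and t: "0 \<le> t" "t \<le> pi" and r: "density d \<rho>"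
  shows "cos t \<le> Re (tr (W * \<rho>))"
proof -
  have psd: "psd d \<rho>" and tr: "tr \<rho> = 1" using r by (auto simp: density_def)
  have c: "Q \<in> carrier_mat d d" "\<rho> \<in> carrier_mat d d" using Q psd by (auto simp: unitary_def dest: psd_carrier)
  define R where "R = adj Q * \<rho> * Q"
  have R: "R \<in> carrier_mat d d" using c by (simp add: R_def)
  have hR: "hermitian d R"
    using psd_conj[OF psd, of "adj Q" d] c by (simp add: R_def psd_def)
  have "W * \<rho> = Q * (diagm d (\<lambda>i. cis (- l i)) * adj Q * \<rho>)"
    unfolding W using c by (simp add: assoc_mult_mat[of _ d d _ d _ d])
  hence "tr (W * \<rho>) = tr (diagm d (\<lambda>i. cis (- l i)) * adj Q * \<rho> * Q)"
    using c by (simp add: tr_mult_commute[of Q d d])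
  also have "diagm d (\<lambda>i. cis (- l i)) * adj Q * \<rho> * Q = diagm d (\<lambda>i. cis (- l i)) * R"
    unfolding R_def using c by (simp add: assoc_mult_mat[of _ d d _ d _ d])
  also have "tr \<dots> = (\<Sum>i<d. cis (- l i) * R $$ (i,i))"
  proof -
    have "(diagm d (\<lambda>i. cis (- l i)) * R) $$ (i,i) = cis (- l i) * R $$ (i,i)" if i: "i < d" for i
    proof -
      have "(diagm d (\<lambda>i. cis (- l i)) * R) $$ (i,i) = (\<Sum>m<d. if m = i then cis (- l i) * R $$ (i,i) else 0)"
        unfolding index_mult_sum[OF diagm_carrier R i i] using i by (intro sum.cong) auto
      thus ?thesis using i by simp
    qed
    thus ?thesis using R by (simp add: tr_def del: index_mult_mat(1))
  qed
  finally have "Re (tr (W * \<rho>)) = (\<Sum>i<d. Re (cis (- l i) * R $$ (i,i)))" by simp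
  also have "\<dots> = (\<Sum>i<d. cos (l i) * diag_in Q \<rho> i)"
  proof (intro sum.cong refl)
    fix i assume "i \<in> {..<d}"
    hence "cnj (R $$ (i,i)) = R $$ (i,i)" using hermitian_entry[OF hR] by simp
    hence "Im (R $$ (i,i)) = 0" by (simp add: complex_eq_iff)
    thus "Re (cis (- l i) * R $$ (i,i)) = cos (l i) * diag_in Q \<rho> i" by (simp add: diag_in_def R_def del: index_mult_mat)
  qed
  also have "\<dots> \<ge> (\<Sum>i<d. cos t * diag_in Q \<rho> i)"
  proof (intro sum_mono mult_right_mono)
    fix i assume i: "i \<in> {..<d}"
    show "0 \<le> diag_in Q \<rho> i" using i by (intro diag_in_nonneg[OF c(1) psd]) simp
    have "cos t \<le> cos \<bar>l i\<bar>" using l t i by (intro cos_monotone_0_pi_le) auto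
    thus "cos t \<le> cos (l i)" by simp
  qed
  finally show ?thesis using diag_in_sum[OF Q c(2)] tr by (simp flip: sum_distrib_left)
qed

lemma tr_adj:
  assumes "A \<in> carrier_mat d d"
  shows "tr (adj A) = cnj (tr A)"
  using assms by (auto simp: tr_def intro!: sum.cong)

lemma conj_affine:
  fixes a b :: real
  assumes W: "W \<in> carrier_mat d d" and R: "R \<in> carrier_mat d d"
  defines "M \<equiv> complex_of_real a \<cdot>\<^sub>m W + complex_of_real b \<cdot>\<^sub>m 1\<^sub>m d"
  shows "M * R * adj M = complex_of_real (a\<^sup>2) \<cdot>\<^sub>m (W * R * adj W) + complex_of_real (b\<^sup>2) \<cdot>\<^sub>m R
     + complex_of_real (a * b) \<cdot>\<^sub>m (W * R + R * adj W)"
proof (rule eq_matI)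
  let ?rhs = "complex_of_real (a\<^sup>2) \<cdot>\<^sub>m (W * R * adj W) + complex_of_real (b\<^sup>2) \<cdot>\<^sub>m R
     + complex_of_real (a * b) \<cdot>\<^sub>m (W * R + R * adj W)"
  have M: "M \<in> carrier_mat d d" using W by (simp add: M_def)
  note cs = W R M adj_carrier[OF W] adj_carrier[OF M]
  have rhs: "?rhs \<in> carrier_mat d d" using cs by simp
  show "dim_row (M * R * adj M) = dim_row ?rhs" "dim_col (M * R * adj M) = dim_col ?rhs" using cs by auto
  fix i j assume "i < dim_row ?rhs" "j < dim_col ?rhs"
  hence ij: "i < d" "j < d" using rhs by auto
  have Mij: "M $$ (x,y) = a * W $$ (x,y) + (if x = y then b else 0)" if "x < d" "y < d" for x y
    using that W by (simp add: M_def)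
  have MR: "(M * R) $$ (i,l) = a * (W * R) $$ (i,l) + b * R $$ (i,l)" if l: "l < d" for l
  proof -
    have "(M * R) $$ (i,l) = (\<Sum>m<d. a * (W $$ (i,m) * R $$ (m,l)) + (if m = i then b * R $$ (i,l) else 0))"
      unfolding index_mult_sum[OF M R ij(1) l] using ij by (intro sum.cong) (auto simp: Mij algebra_simps)
    thus ?thesis unfolding index_mult_sum[OF W R ij(1) l] using ij
      by (simp add: sum.distrib sum_distrib_left)
  qed
  have WR: "W * R \<in> carrier_mat d d" "M * R \<in> carrier_mat d d" using cs by simp_all
  have "(M * R * adj M) $$ (i,j) = (\<Sum>l<d. a * ((M * R) $$ (i,l) * adj W $$ (l,j)) + (if l = j then b * (M * R) $$ (i,j) else 0))"
    unfolding index_mult_sum[OF WR(2) adj_carrier[OF M] ij]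
    using M W ij by (intro sum.cong) (auto simp: Mij algebra_simps simp del: index_mult_mat(1))
  also have "\<dots> = a * (\<Sum>l<d. (M * R) $$ (i,l) * adj W $$ (l,j)) + b * (M * R) $$ (i,j)"
    using ij by (simp add: sum.distrib sum_distrib_left del: index_mult_mat(1))
  also have "(\<Sum>l<d. (M * R) $$ (i,l) * adj W $$ (l,j))
     = a * (\<Sum>l<d. (W * R) $$ (i,l) * adj W $$ (l,j)) + b * (\<Sum>l<d. R $$ (i,l) * adj W $$ (l,j))"
    by (simp add: MR sum.distrib sum_distrib_left algebra_simps del: index_mult_mat(1))
  also have "(\<Sum>l<d. (W * R) $$ (i,l) * adj W $$ (l,j)) = (W * R * adj W) $$ (i,j)"
    by (rule index_mult_sum[OF WR(1) adj_carrier[OF W] ij, symmetric])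
  also have "(\<Sum>l<d. R $$ (i,l) * adj W $$ (l,j)) = (R * adj W) $$ (i,j)"
    by (rule index_mult_sum[OF R adj_carrier[OF W] ij, symmetric])
  also have "a * (a * (W * R * adj W) $$ (i,j) + b * (R * adj W) $$ (i,j)) + b * (M * R) $$ (i,j) = ?rhs $$ (i,j)"
  proof -
    have "?rhs $$ (i,j) = complex_of_real (a\<^sup>2) * (W * R * adj W) $$ (i,j) + complex_of_real (b\<^sup>2) * R $$ (i,j)
     + complex_of_real (a * b) * ((W * R) $$ (i,j) + (R * adj W) $$ (i,j))"
      using cs ij by (simp del: index_mult_mat(1))
    thus ?thesis unfolding MR[OF ij(2)] by (simp add: algebra_simps power2_eq_square del: index_mult_mat(1))
  qed
  finally show "(M * R * adj M) $$ (i,j) = ?rhs $$ (i,j)" .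
qed

text \<open>With \<open>c\<^sup>2 - s\<^sup>2 = 1\<close>, the hyperbolic rotation \<open>(W, 1) \<mapsto> (c W - s, c - s W)\<close> preserves
  \<open>W \<rho> W\<^sup>\<dagger> - \<rho>\<close> as a difference of positive operators; at the rapidity with
  \<open>2 c s / (c\<^sup>2 + s\<^sup>2) = cos t\<close> their trace drops to at most \<open>sin t\<close>. This replaces the Jordan
  decomposition and the purification argument for the trace distance.\<close>

lemma unitary_perturbation_split:
  assumes W: "unitary d W" and r: "density d \<rho>" and t: "0 < t" "t < pi / 2"
    and re: "cos t \<le> Re (tr (W * \<rho>))"
  shows "\<exists>N P. psd d N \<and> psd d P \<and> W * \<rho> * adj W + N = \<rho> + P \<and> Re (tr N) \<le> sin t \<and> Re (tr P) \<le> sin t"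
proof -
  have psd: "psd d \<rho>" and tr: "tr \<rho> = 1" using r by (auto simp: density_def)
  have Wc: "W \<in> carrier_mat d d" using W by (rule unitary_carrier)
  have Rc: "\<rho> \<in> carrier_mat d d" using psd by (rule psd_carrier)
  have sint: "0 < sin t" "sin t \<le> 1" and cost: "0 < cos t" using t by (auto intro: sin_gt_zero cos_gt_zero)
  have inv: "1 \<le> 1 / sin t" using sint by simp
  \<comment> \<open>\<open>c\<close> and \<open>s\<close> are cosh \<theta> and sinh \<theta>. The
    trace bound cosh 2\<theta> - cos t sinh 2\<theta> is least where tanh 2\<theta> = cos t, with
    value sin t; there cosh 2\<theta> = 1 / sin t, and the half-angle formulas give the
    roots.\<close>
  define c where "c = sqrt ((1 / sin t + 1) / 2)"
  define s where "s = sqrt ((1 / sin t - 1) / 2)"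
  have c2: "c\<^sup>2 = (1 / sin t + 1) / 2" and s2: "s\<^sup>2 = (1 / sin t - 1) / 2" using inv sint by (simp_all add: c_def s_def)
  have cs0: "0 \<le> c * s" using inv sint by (simp add: c_def s_def)
  have "(2 * (c * s))\<^sup>2 = (1 / sin t + 1) * (1 / sin t - 1)"
    by (simp add: power_mult_distrib c2 s2)
  also have "\<dots> = (1 - (sin t)\<^sup>2) / (sin t)\<^sup>2" using sint by (simp add: field_simps power2_eq_square)
  also have "\<dots> = (cos t / sin t)\<^sup>2" by (simp add: cos_squared_eq power_divide)
  finally have "2 * (c * s) = cos t / sin t" by (rule power2_eq_imp_eq) (use cs0 sint cost in auto)
  hence "2 * (c * s) * cos t = (1 - (sin t)\<^sup>2) / sin t"
    unfolding cos_squared_eq[symmetric] by (simp add: power2_eq_square)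
  moreover have "c\<^sup>2 + s\<^sup>2 = 1 / sin t" by (simp add: c2 s2 field_simps)
  ultimately have cs: "c\<^sup>2 + s\<^sup>2 - 2 * (c * s) * cos t = sin t"
    using sint by (simp add: diff_divide_distrib power2_eq_square)
  define X where "X = W * \<rho> * adj W"
  define G where "G = W * \<rho> + \<rho> * adj W"
  have Xc: "X \<in> carrier_mat d d" and Gc: "G \<in> carrier_mat d d" using Wc Rc by (simp_all add: X_def G_def)
  define aff where "aff a b = complex_of_real a \<cdot>\<^sub>m W + complex_of_real b \<cdot>\<^sub>m 1\<^sub>m d" for a b
  define Y where "Y a b = aff a b * \<rho> * adj (aff a b)" for a b
  have affc: "aff a b \<in> carrier_mat d d" for a b using Wc by (simp add: aff_def)
  have psdY: "psd d (Y a b)" for a b unfolding Y_def by (rule psd_conj[OF psd affc])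
  have Yeq: "Y a b = complex_of_real (a\<^sup>2) \<cdot>\<^sub>m X + complex_of_real (b\<^sup>2) \<cdot>\<^sub>m \<rho> + complex_of_real (a * b) \<cdot>\<^sub>m G" for a b
    unfolding Y_def aff_def X_def G_def by (rule conj_affine[OF Wc Rc])
  have "tr X = 1" unfolding X_def using tr_unitary_conj[OF W Rc] tr by simp
  moreover have "tr G = 2 * complex_of_real (Re (tr (W * \<rho>)))"
  proof -
    have "adj (W * \<rho>) = \<rho> * adj W" using Wc Rc psd_adj[OF psd] by (simp add: adj_mult[of _ d d _ d])
    hence "tr (\<rho> * adj W) = cnj (tr (W * \<rho>))" using tr_adj[of "W * \<rho>" d] Wc Rc by simp
    thus ?thesis unfolding G_def using Wc Rc by (simp add: tr_add[of _ d] complex_add_cnj)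
  qed
  ultimately have trY: "Re (tr (Y a b)) = a\<^sup>2 + b\<^sup>2 + 2 * (a * b) * Re (tr (W * \<rho>))" for a b
    unfolding Yeq using Xc Rc Gc tr by (simp add: tr_add[of _ d] tr_smult)
  have le: "c\<^sup>2 + s\<^sup>2 - 2 * (c * s) * Re (tr (W * \<rho>)) \<le> sin t"
    using mult_left_mono[OF re, of "2 * (c * s)"] cs0 cs by simp
  \<comment> \<open>The cross terms carry the same coefficient -cs on both sides and cancel; what
    remains is 1 + s^2 = c^2, for \<open>X\<close> and for \<rho> alike.\<close>
  have "X + Y (- s) c = \<rho> + Y c (- s)"
  proof (rule eq_matI)
    fix i j assume "i < dim_row (\<rho> + Y c (- s))" "j < dim_col (\<rho> + Y c (- s))"
    hence ij: "i < d" "j < d" using psd_carrier[OF psdY[of c "- s"]] by simp_all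
    have "complex_of_real (c\<^sup>2) = complex_of_real (s\<^sup>2) + 1"
      unfolding c2 s2 by (simp add: field_simps)
    thus "(X + Y (- s) c) $$ (i,j) = (\<rho> + Y c (- s)) $$ (i,j)"
      unfolding Yeq using Xc Rc Gc ij by (simp add: algebra_simps del: of_real_power)
  qed (use psd_carrier[OF psdY[of c "- s"]] psd_carrier[OF psdY[of "- s" c]] in simp_all)
  moreover have "Re (tr (Y (- s) c)) \<le> sin t" "Re (tr (Y c (- s))) \<le> sin t"
    unfolding trY using le by (simp_all add: mult_ac add.commute)
  ultimately show ?thesis using psdY unfolding X_def by blast
qed

section \<open>Continuity across the cut\<close>

lemma add_left_cancel_mat:
  assumes "A + B = A + C" "A \<in> carrier_mat n m" "B \<in> carrier_mat n m" "C \<in> carrier_mat n m"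
  shows "B = (C :: complex mat)"
proof -
  have "A + B - A = A + C - A" using assms(1) by simp
  thus ?thesis by (simp only: add_minus_cancel_mat(1)[OF assms(2,3)] add_minus_cancel_mat(1)[OF assms(2,4)])
qed

lemma hbin_nonneg:
  assumes "0 \<le> x" "x \<le> 1"
  shows "0 \<le> hbin x"
proof -
  have *: "y * ln y \<le> 0" if "0 \<le> y" "y \<le> 1" for y :: real
    using that by (cases "y = 0") (auto simp: mult_le_0_iff)
  show ?thesis using *[of x] *[of "1 - x"] assms by (simp add: hbin_def)
qed

lemma conj_phase:
  assumes z: "cmod z = 1" and U: "U \<in> carrier_mat d d" and X: "X \<in> carrier_mat d d"
  shows "(z \<cdot>\<^sub>m U) * X * adj (z \<cdot>\<^sub>m U) = U * X * adj U"
proof -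
  have "z * cnj z = 1" using complex_norm_square[of z] z by simp
  have zU: "z \<cdot>\<^sub>m U \<in> carrier_mat d d" using U by simp
  show ?thesis
  proof (rule eq_matI)
    fix i j assume "i < dim_row (U * X * adj U)" "j < dim_col (U * X * adj U)"
    hence ij: "i < d" "j < d" using U by auto
    show "((z \<cdot>\<^sub>m U) * X * adj (z \<cdot>\<^sub>m U)) $$ (i,j) = (U * X * adj U) $$ (i,j)"
      unfolding index_conj[OF zU X ij] index_conj[OF U X ij]
    proof (intro sum.cong refl)
      fix k l assume "k \<in> {..<d}" "l \<in> {..<d}"
      hence "(z \<cdot>\<^sub>m U) $$ (i,k) * X $$ (k,l) * cnj ((z \<cdot>\<^sub>m U) $$ (j,l))
         = (z * cnj z) * (U $$ (i,k) * X $$ (k,l) * cnj (U $$ (j,l)))"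
        using ij U by (simp add: mult_ac)
      thus "(z \<cdot>\<^sub>m U) $$ (i,k) * X $$ (k,l) * cnj ((z \<cdot>\<^sub>m U) $$ (j,l))
         = U $$ (i,k) * X $$ (k,l) * cnj (U $$ (j,l))"
        by (simp only: \<open>z * cnj z = 1\<close> mult_1)
    qed
  qed (use U in auto)
qed

lemma gate_perturbation_split:
  assumes U: "unitary d U" and r: "density d \<rho>" and d: "0 < d" and t: "gate_cost U < t" "t < pi / 2"
  shows "\<exists>N P. psd d N \<and> psd d P \<and> U * \<rho> * adj U + N = \<rho> + P \<and> Re (tr N) \<le> sin t \<and> Re (tr P) \<le> sin t"
proof -
  obtain Q l z where Q: "unitary d Q" "\<forall>i<d. \<bar>l i\<bar> \<le> t" "cmod z = 1"
      and W: "z \<cdot>\<^sub>m U = Q * diagm d (\<lambda>i. cis (- l i)) * adj Q"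
    using gate_cost_less[OF U t(1)] by blast
  have Uc: "U \<in> carrier_mat d d" and UU: "adj U * U = 1\<^sub>m d" using U by (auto simp: unitary_def)
  have t0: "0 < t" using gate_cost_nonneg[OF U d] t by simp
  have Rc: "\<rho> \<in> carrier_mat d d" using r by (auto simp: density_def dest: psd_carrier)
  have "unitary d (z \<cdot>\<^sub>m U)"
  proof (rule unitaryI)
    have "adj (z \<cdot>\<^sub>m U) * (z \<cdot>\<^sub>m U) = (z * cnj z) \<cdot>\<^sub>m (adj U * U)"
      using Uc by (simp add: adj_smult mult_smult_distrib[of _ d d _ d] mult_smult_assoc_mat[of _ d d _ d])
        (auto intro!: eq_matI)
    also have "z * cnj z = 1" using complex_norm_square[of z] Q(3) by simp
    finally show "adj (z \<cdot>\<^sub>m U) * (z \<cdot>\<^sub>m U) = 1\<^sub>m d" using UU by (auto intro!: eq_matI)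
  qed (use Uc in simp)
  moreover have "cos t \<le> Re (tr (z \<cdot>\<^sub>m U * \<rho>))"
    by (rule Re_tr_mult_ge_cos[OF Q(1) W Q(2) _ _ r]) (use t0 t in auto)
  ultimately show ?thesis
    using unitary_perturbation_split[of d "z \<cdot>\<^sub>m U" \<rho> t] r t0 t(2) conj_phase[OF Q(3) Uc Rc] by auto
qed

text \<open>The global entropies cancel, so the change is the sum of two marginal changes, estimated
  by splitting off S_k on the left and S_{k+1} on the right. Each estimate is therefore twice the
  one for a single split-off qubit.\<close>

lemma
  assumes V: "unitary 4 V" and k: "1 \<le> k" "k + 1 \<le> n" and r: "density (2^n) \<rho>"
  defines "U \<equiv> embed2 n k V"
  shows mutual_info_cut_le_ln2: "\<bar>mutual_info n k (U * \<rho> * adj U) - mutual_info n k \<rho>\<bar> \<le> 4 * ln 2"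
    and mutual_info_cut_le: "\<lbrakk>psd (2^n) N; psd (2^n) P; U * \<rho> * adj U + N = \<rho> + P;
       Re (tr N) \<le> v; Re (tr P) \<le> v; 0 < v\<rbrakk> \<Longrightarrow>
       \<bar>mutual_info n k (U * \<rho> * adj U) - mutual_info n k \<rho>\<bar> \<le> 4 * v * ln 2 + 2 * (1 + v) * hbin (v / (1 + v))"
proof -
  define \<sigma> where "\<sigma> = U * \<rho> * adj U"
  have psd: "psd (2^n) \<rho>" and tr: "tr \<rho> = 1" using r by (auto simp: density_def)
  have U: "unitary (2^n) U" unfolding U_def by (rule unitary_embed2[OF V k])
  have Uc: "U \<in> carrier_mat (2^n) (2^n)" using U by (rule unitary_carrier)
  have Rc: "\<rho> \<in> carrier_mat (2^n) (2^n)" using psd by (rule psd_carrier)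
  have psd': "psd (2^n) \<sigma>" unfolding \<sigma>_def by (rule psd_conj[OF psd Uc])
  have Sc: "\<sigma> \<in> carrier_mat (2^n) (2^n)" using psd' by (rule psd_carrier)
  have tr': "tr \<sigma> = 1" unfolding \<sigma>_def using tr_unitary_conj[OF U Rc] tr by simp
  have H: "vn_entropy \<sigma> = vn_entropy \<rho>" unfolding \<sigma>_def by (rule vn_entropy_unitary_conj[OF U psd])
  have kn: "k \<le> n" and k1: "k - 1 \<le> n" using k by auto
  note pf = pairing_first and pl = pairing_last
  have d1: "(2::nat)^k = 2 * 2^(k-1)" using k by (cases k) auto
  have "n - k = Suc (n - k - 1)" using k by simp
  hence d2: "(2::nat)^(n-k) = 2 * 2^(n-k-1)" by (metis power_Suc)
  note q1 = qubit_split_last[of "2^(k-1)"] and q2 = qubit_split_first[of "2^(n-k-1)"]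
  have psd1: "psd (2 * 2^(k-1)) (red_first n k X)" if "psd (2^n) X" for X
    unfolding red_first_pt[OF kn] using pairing.psd_pt[OF pf[OF kn] that] by (simp only: d1)
  have psd2: "psd (2 * 2^(n-k-1)) (red_last n k X)" if "psd (2^n) X" for X
    unfolding red_last_pt[OF kn] using pairing.psd_pt[OF pl[OF kn] that] by (simp only: d2)
  have tr1: "tr (red_first n k X) = tr X" if "X \<in> carrier_mat (2^n) (2^n)" for X
    unfolding red_first_pt[OF kn] by (rule pairing.tr_pt[OF pf[OF kn] that])
  have tr2: "tr (red_last n k X) = tr X" if "X \<in> carrier_mat (2^n) (2^n)" for X
    unfolding red_last_pt[OF kn] by (rule pairing.tr_pt[OF pl[OF kn] that])
  have add1: "red_first n j (X + Y) = red_first n j X + red_first n j Y"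
    if "X \<in> carrier_mat (2^n) (2^n)" "Y \<in> carrier_mat (2^n) (2^n)" "j \<le> n" for X Y j
    unfolding red_first_pt[OF that(3)] by (rule pairing.pt_add[OF pf[OF that(3)] that(1,2)])
  have add2: "red_last n j (X + Y) = red_last n j X + red_last n j Y"
    if "X \<in> carrier_mat (2^n) (2^n)" "Y \<in> carrier_mat (2^n) (2^n)" "j \<le> n" for X Y j
    unfolding red_last_pt[OF that(3)] by (rule pairing.pt_add[OF pl[OF that(3)] that(1,2)])
  have m1: "red_first n (k-1) \<sigma> = red_first n (k-1) \<rho>"
    unfolding \<sigma>_def U_def by (rule red_first_embed2[OF V k Rc])
  have m2: "red_last n (k+1) \<sigma> = red_last n (k+1) \<rho>"
    unfolding \<sigma>_def U_def by (rule red_last_embed2[OF V k Rc])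
  have diff: "mutual_info n k \<sigma> - mutual_info n k \<rho> =
     (vn_entropy (red_first n k \<sigma>) - vn_entropy (red_first n k \<rho>)) + (vn_entropy (red_last n k \<sigma>) - vn_entropy (red_last n k \<rho>))"
    by (simp add: mutual_info_def H)

  have "\<bar>vn_entropy (red_first n k \<sigma>) - vn_entropy (red_first n k \<rho>)\<bar> \<le> 2 * ln 2"
    by (rule qubit_split.abs_vn_entropy_diff_le_ln2[OF q1 psd1[OF psd'] psd1[OF psd]])
      (simp_all only: tr1 Sc Rc tr tr' marg_red_first[OF k(1) kn] m1)
  moreover have "\<bar>vn_entropy (red_last n k \<sigma>) - vn_entropy (red_last n k \<rho>)\<bar> \<le> 2 * ln 2"
    by (rule qubit_split.abs_vn_entropy_diff_le_ln2[OF q2 psd2[OF psd'] psd2[OF psd]])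
      (simp_all only: tr2 Sc Rc tr tr' marg_red_last[OF k(2)] m2)
  ultimately show "\<bar>mutual_info n k (U * \<rho> * adj U) - mutual_info n k \<rho>\<bar> \<le> 4 * ln 2"
    using diff unfolding \<sigma>_def by linarith

  assume N: "psd (2^n) N" and P: "psd (2^n) P" and eq: "U * \<rho> * adj U + N = \<rho> + P"
    and tN: "Re (tr N) \<le> v" and tP: "Re (tr P) \<le> v" and v: "0 < v"
  have Nc: "N \<in> carrier_mat (2^n) (2^n)" and Pc: "P \<in> carrier_mat (2^n) (2^n)" using N P by (auto dest: psd_carrier)
  have eq1: "red_first n j \<sigma> + red_first n j N = red_first n j \<rho> + red_first n j P" if "j \<le> n" for j
    using add1[OF Sc Nc that] add1[OF Rc Pc that] eq by (simp add: \<sigma>_def)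
  have eq2: "red_last n j \<sigma> + red_last n j N = red_last n j \<rho> + red_last n j P" if "j \<le> n" for j
    using add2[OF Sc Nc that] add2[OF Rc Pc that] eq by (simp add: \<sigma>_def)
  \<comment> \<open>The fixed marginals of \<open>\<sigma>\<close> and \<open>\<rho>\<close> cancel
    from the reduced balance equation.\<close>
  have n1: "red_first n (k-1) N = red_first n (k-1) P"
    by (rule add_left_cancel_mat[OF eq1[OF k1, unfolded m1], of "2^(k-1)" "2^(k-1)"]) (simp_all add: red_first_def)
  have n2: "red_last n (k+1) N = red_last n (k+1) P"
    by (rule add_left_cancel_mat[OF eq2[OF k(2), unfolded m2], of "2^(n-(k+1))" "2^(n-(k+1))"]) (simp_all add: red_last_def)
  define b where "b = 2 * v * ln 2 + (1 + v) * hbin (v / (1 + v))"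
  have "\<bar>vn_entropy (red_first n k \<sigma>) - vn_entropy (red_first n k \<rho>)\<bar> \<le> b"
    unfolding b_def by (rule qubit_split.abs_vn_entropy_diff_le[OF q1 psd1[OF psd'] psd1[OF psd] psd1[OF N] psd1[OF P] eq1[OF kn]])
      (simp_all only: tr1 Sc Rc Nc Pc tr tr' marg_red_first[OF k(1) kn] n1 tN tP v)
  moreover have "\<bar>vn_entropy (red_last n k \<sigma>) - vn_entropy (red_last n k \<rho>)\<bar> \<le> b"
    unfolding b_def by (rule qubit_split.abs_vn_entropy_diff_le[OF q2 psd2[OF psd'] psd2[OF psd] psd2[OF N] psd2[OF P] eq2[OF kn]])
      (simp_all only: tr2 Sc Rc Nc Pc tr tr' marg_red_last[OF k(2)] n2 tN tP v)
  ultimately have "\<bar>mutual_info n k \<sigma> - mutual_info n k \<rho>\<bar> \<le> 2 * b"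
    using diff by linarith
  thus "\<bar>mutual_info n k (U * \<rho> * adj U) - mutual_info n k \<rho>\<bar> \<le> 4 * v * ln 2 + 2 * (1 + v) * hbin (v / (1 + v))"
    by (simp add: \<sigma>_def b_def algebra_simps)
qed

text \<open>Clearing the quotients isolates \<open>eta v\<close> as the only term whose continuity
  at 0 is delicate. The equation holds at v = 0 as well, with \<open>ln 0 = 0\<close>.\<close>

lemma hbin_scaled_eq:
  assumes "0 \<le> v"
  shows "(1 + v) * hbin (v / (1 + v)) = (1 + v) * ln (1 + v) + eta v"
proof (cases "v = 0")
  case False
  hence v: "v > 0" using assms by simp
  have 1: "1 - v / (1 + v) = 1 / (1 + v)" using v by (simp add: field_simps)
  have 2: "ln (v / (1 + v)) = ln v - ln (1 + v)" "ln (1 / (1 + v)) = - ln (1 + v)"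
    using v by (simp_all add: ln_div)
  have 3: "(1 + v) * (v / (1 + v)) = v" "(1 + v) * (1 / (1 + v)) = 1" using v by simp_all
  have "(1 + v) * hbin (v / (1 + v)) =
     - ((1 + v) * (v / (1 + v))) * ln (v / (1 + v)) - ((1 + v) * (1 / (1 + v))) * ln (1 / (1 + v))"
    unfolding hbin_def 1 by (simp only: right_diff_distrib mult_minus_left mult_minus_right mult.assoc)
  also have "\<dots> = (1 + v) * ln (1 + v) + eta v"
    unfolding 2 3 using v by (simp add: eta_def algebra_simps)
  finally show ?thesis .
qed (simp add: hbin_def eta_def)

lemma eta_tendsto_at_right:
  assumes "0 \<le> a"
  shows "(eta \<longlongrightarrow> eta a) (at_right a)"
proof -
  have "((\<lambda>x. - x * ln x) \<longlongrightarrow> eta a) (at_right a)"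
  proof (cases "a = 0")
    case True
    have "((\<lambda>x::real. - x * ln x) \<longlongrightarrow> 0) (at_right 0)" by real_asymp
    thus ?thesis by (simp add: True eta_def)
  next
    case False
    have "((\<lambda>x. - x * ln x) \<longlongrightarrow> - a * ln a) (at_right a)"
      using False by (intro tendsto_intros) auto
    thus ?thesis using False assms by (simp add: eta_def)
  qed
  moreover have "eventually (\<lambda>x. - x * ln x = eta x) (at_right a)"
    using assms by (intro eventually_at_rightI[of a "a + 1"]) (auto simp: eta_def)
  ultimately show ?thesis by (rule Lim_transform_eventually)
qed

lemma bound_tendsto_at_right:
  assumes "0 \<le> a"
  shows "((\<lambda>v. 8 * v * ln 2 + 3 * (1 + v) * hbin (v / (1 + v)))
     \<longlongrightarrow> 8 * a * ln 2 + 3 * (1 + a) * hbin (a / (1 + a))) (at_right a)"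
proof -
  have eq: "8 * v * ln 2 + 3 * (1 + v) * hbin (v / (1 + v)) = 8 * v * ln 2 + 3 * ((1 + v) * ln (1 + v) + eta v)"
    if "0 \<le> v" for v by (simp only: mult.assoc hbin_scaled_eq[OF that])
  have "((\<lambda>v. 8 * v * ln 2 + 3 * ((1 + v) * ln (1 + v) + eta v))
     \<longlongrightarrow> 8 * a * ln 2 + 3 * ((1 + a) * ln (1 + a) + eta a)) (at_right a)"
    using assms by (intro tendsto_intros eta_tendsto_at_right) auto
  moreover have "eventually (\<lambda>v. 8 * v * ln 2 + 3 * ((1 + v) * ln (1 + v) + eta v)
     = 8 * v * ln 2 + 3 * (1 + v) * hbin (v / (1 + v))) (at_right a)"
    using assms eq by (intro eventually_at_rightI[of a "a + 1"]) auto
  ultimately show ?thesis unfolding eq[OF assms] by (rule Lim_transform_eventually)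
qed

theorem theoremG1:
  fixes n k :: nat and \<rho> V U :: "complex mat"
  assumes "n \<ge> 2"
    and "density (2^n) \<rho>"
    and "1 \<le> k" and "k \<le> n - 1"
    and "unitary 4 V"
    and "U = embed2 n k V"
  shows "let \<nu> = sin (min (gate_cost U) (pi/2)) in
    \<bar>chain_E n (U * \<rho> * adj U) - chain_E n \<rho>\<bar>
      \<le> (1 / (real n - 1)) * min (8 * ln 2) (8 * \<nu> * ln 2 + 3 * (1 + \<nu>) * hbin (\<nu> / (1 + \<nu>)))"
proof -
  have k: "1 \<le> k" "k + 1 \<le> n" using assms by auto
  have psd: "psd (2^n) \<rho>" using assms(2) by (simp add: density_def)
  have U: "unitary (2^n) U" unfolding assms(6) by (rule unitary_embed2[OF assms(5) k])
  define K where "K = \<bar>mutual_info n k (U * \<rho> * adj U) - mutual_info n k \<rho>\<bar>"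
  define B where "B v = 8 * v * ln 2 + 3 * (1 + v) * hbin (v / (1 + v))" for v :: real
  define e where "e = gate_cost U"
  have e0: "0 \<le> e" unfolding e_def by (rule gate_cost_nonneg[OF U]) simp
  have hb: "0 \<le> hbin (v / (1 + v))" if "0 \<le> v" for v using that by (intro hbin_nonneg) auto
  have K4: "K \<le> 4 * ln 2"
    unfolding K_def assms(6) by (rule mutual_info_cut_le_ln2[OF assms(5) k assms(2)])
  have KB: "K \<le> B (sin t)" if t: "e < t" "t < pi / 2" for t
  proof -
    have s: "0 < sin t" using t e0 by (intro sin_gt_zero) auto
    \<comment> \<open>The surplus of the claimed bound over the one obtained at the cut.\<close>
    have "0 \<le> 4 * sin t * ln 2 + (1 + sin t) * hbin (sin t / (1 + sin t))"
      using s hb[of "sin t"] by simp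
    moreover have "K \<le> 4 * sin t * ln 2 + 2 * (1 + sin t) * hbin (sin t / (1 + sin t))"
      using gate_perturbation_split[OF U assms(2) _ t[unfolded e_def]]
        mutual_info_cut_le[OF assms(5) k assms(2), of _ _ "sin t"] s
      unfolding K_def assms(6) by auto
    ultimately show ?thesis by (simp add: B_def algebra_simps)
  qed
  have "K \<le> B (sin (min e (pi / 2)))"
  proof (cases "e < pi / 2")
    case True
    \<comment> \<open>The bound is controlled from the right only, so sin t has to approach sin e
      from strictly above; sine increases strictly on [0, pi/2].\<close>
    have "filterlim sin (at_right (sin e)) (at_right e)"
    proof (rule tendsto_imp_filterlim_at_right)
      show "(sin \<longlongrightarrow> sin e) (at_right e)" by (intro tendsto_intros)
      show "eventually (\<lambda>t. sin e < sin t) (at_right e)"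
        using True e0 by (intro eventually_at_rightI[of e "pi / 2"]) (auto intro!: sin_monotone_2pi)
    qed
    moreover have "(B \<longlongrightarrow> B (sin e)) (at_right (sin e))"
      unfolding B_def using True e0 by (intro bound_tendsto_at_right sin_ge_zero) auto
    ultimately have "((\<lambda>t. B (sin t)) \<longlongrightarrow> B (sin e)) (at_right e)" by (rule filterlim_compose[rotated])
    moreover have "eventually (\<lambda>t. K \<le> B (sin t)) (at_right e)"
      using True KB by (intro eventually_at_rightI[of e "pi / 2"]) auto
    ultimately have "K \<le> B (sin e)" by (rule tendsto_lowerbound) simp
    thus ?thesis using True by simp
  next
    case False
    hence "sin (min e (pi / 2)) = 1" by simp
    hence "B (sin (min e (pi / 2))) = B 1" by (simp only:)
    moreover have "B 1 = 8 * ln 2 + 6 * hbin (1 / 2)" by (simp add: B_def)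
    moreover have "0 \<le> hbin (1 / 2)" using hb[of 1] by simp
    moreover have "0 < ln (2::real)" by simp
    ultimately show ?thesis using K4 by linarith
  qed
  moreover have "K \<le> 8 * ln 2" using K4 ln_ge_zero[of 2] by linarith
  ultimately have main: "K \<le> min (8 * ln 2) (B (sin (min e (pi / 2))))" by simp
  have "(\<Sum>j=1..n-1. mutual_info n j (U * \<rho> * adj U)) - (\<Sum>j=1..n-1. mutual_info n j \<rho>)
     = (\<Sum>j=1..n-1. if j = k then mutual_info n k (U * \<rho> * adj U) - mutual_info n k \<rho> else 0)"
    unfolding sum_subtractf[symmetric]
  proof (intro sum.cong refl)
    fix j assume "j \<in> {1..n-1}"
    thus "mutual_info n j (U * \<rho> * adj U) - mutual_info n j \<rho>
       = (if j = k then mutual_info n k (U * \<rho> * adj U) - mutual_info n k \<rho> else 0)"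
      using mutual_info_embed2[OF assms(5) k _ _ psd, of j] by (auto simp: assms(6))
  qed
  also have "\<dots> = mutual_info n k (U * \<rho> * adj U) - mutual_info n k \<rho>" using assms(3,4) by simp
  finally have "chain_E n (U * \<rho> * adj U) - chain_E n \<rho>
     = (1 / (real n - 1)) * (mutual_info n k (U * \<rho> * adj U) - mutual_info n k \<rho>)"
    by (simp only: chain_E_def flip: right_diff_distrib)
  hence "\<bar>chain_E n (U * \<rho> * adj U) - chain_E n \<rho>\<bar> = (1 / (real n - 1)) * K"
    using assms(1) by (simp add: abs_mult K_def)
  also have "\<dots> \<le> (1 / (real n - 1)) * min (8 * ln 2) (B (sin (min e (pi / 2))))"
    using main assms(1) by (intro mult_left_mono) auto
  finally show ?thesis unfolding Let_def B_def e_def .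
qed

end
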